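(* Let $X$ be a concrete cubeset with the gluing property and let $n\ge0$. For a map $f\colon\mathrm{Sub}[n]\to X(0)$ the following are equivalent. (a) For every $m$ and every $c\in K_n(m)$ the configuration $f\circ c\colon\{0,1\}^m\to X(0)$ is in $X(m)$. (b) For every $m\ge 1$ and every map $\sigma\colon[m]\to[n]$ in $\Delta$ the configuration $f\circ\sigma_\ast\circ C_m\colon\{0,1\}^m\to X(0)$ is in $X(m)$. (c) For every injection $i\colon[m]\to[n]$ in $\Delta$ the configurations $f\circ i_\ast\circ C_m$ (for $m\ge1$) and $f\circ i_\ast\circ D_m$ (for $m\ge 0$), both maps $\{0,1\}^m\to X(0)$, are in $X(m)$. In particular, the set $K^\ast_nX$ of $n$-simplices of $K^\ast X$ consists of all maps $f\colon\mathrm{Sub}[n]\to X(0)$ fulfilling one of these equivalent conditions.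
   Context: **Cubesets.** The category $\square$ has objects $\{0,1\}^n$, $n\ge 0$, and morphisms the maps $\{0,1\}^n\to\{0,1\}^m$ that are restrictions of affine linear maps $\mathbb Z^n\to\mathbb Z^m$. A cubeset is a presheaf of sets $X$ on $\square$, with $X(n)$ its value at $\{0,1\}^n$. It is concrete if $X(n)\to X(0)^{\{0,1\}^n}$ (restriction to vertices) is injective for all $n$; then elements of $X(n)$ are identified with maps $\{0,1\}^n\to X(0)$. Gluing property (concrete $X$): whenever $a,b\in X(n)$ agree on a face $[x_j=\epsilon]$ ($0\le j<n$, $\epsilon\in\{0,1\}$), the configuration whose value at $x$ is $a$ at ($x$ with $x_j$ replaced by $1-\epsilon$) if $x_j=1$, and $b$ at ($x$ with $x_j$ replaced by $1-\epsilon$) if $x_j=0$, is again in $X(n)$. **Formal cubes.** $\mathrm{Sub}[n]$ is the set of nonempty subsets of $\{0,\dots,n\}$; $\Delta$ is the simplex category; $\sigma\colon[k]\to[n]$ in $\Delta$ induces $\sigma_\ast\colon\mathrm{Sub}[k]\to\mathrm{Sub}[n]$ by direct image. A formal $k$-cube with labels in $[k]$ is a map $A\colon\{0,1\}^k\to\mathrm{Sub}[k]$; points are $x=(x_0,\dots,x_{k-1})$ with the convention $x_{-1}=1$, $x_k=0$; its label functions are $f_i\colon\{0,1\}^k\to\{0,1\}$ with $f_i(x)=1\iff i\in A(x)$. $A$ is degenerable if for every $0\le i<k$, $\sigma_{i,\ast}\circ A$ does not depend on $x_i$, where $\sigma_i\colon[k]\to[k-1]$ is the degeneracy identifying $i$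 and $i+1$. $C_m$ ($m\ge1$) is the formal $m$-cube with label functions $f_i=x_i\vee\neg x_{i-1}$, $0\le i\le m$. $D_m$ ($m\ge 0$) has $f_i=x_i\vee\neg x_{i-1}$ for $i<m$ and $f_m=1$. **Kernel.** $K_n(m)$ is the set of all composites $\sigma_\ast\circ A\circ\phi\colon\{0,1\}^m\to\mathrm{Sub}[n]$ with $\phi\colon\{0,1\}^m\to\{0,1\}^k$ in $\square$, $A$ a degenerable formal $k$-cube, $\sigma\colon[k]\to[n]$ in $\Delta$, $k\ge0$. This is a cosimplicial cubeset, each $K_n$ being concrete with $K_n(0)=\mathrm{Sub}[n]$. $K^\ast X$ is the simplicial set $[n]\mapsto K^\ast_nX=\mathrm{Hom}(K_n,X)$ (Hom of cubesets); a morphism is identified with its map on $0$-cubes. *)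

theory Defs
  imports Main "HOL-Library.FuncSet"
begin

text \<open>A point of \<open>{0,1}\<^sup>n\<close> is a map \<open>nat \<Rightarrow> bool\<close> that is \<open>False\<close> outside \<open>{..<n}\<close>; this padding
  also provides the convention \<open>x\<^sub>n = 0\<close>. All maps with a given domain are made extensional
  (\<open>undefined\<close> outside the domain), so that equality of maps is equality in HOL.\<close>

definition cube :: "nat \<Rightarrow> (nat \<Rightarrow> bool) set" where
  "cube n = {x. \<forall>i\<ge>n. \<not> x i}"

text \<open>The matrix \<open>M\<close> and the vector \<open>b\<close> give the affine map \<open>x \<mapsto> b + M x\<close> from \<open>\<int>\<^sup>n\<close> to \<open>\<int>\<^sup>m\<close>.\<close>

definition box_hom :: "nat \<Rightarrow> nat \<Rightarrow> ((nat \<Rightarrow> bool) \<Rightarrow> (nat \<Rightarrow> bool)) set" where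
  "box_hom n m = {\<phi> \<in> cube n \<rightarrow>\<^sub>E cube m.
     \<exists>(M :: nat \<Rightarrow> nat \<Rightarrow> int) (b :: nat \<Rightarrow> int). \<forall>x\<in>cube n. \<forall>i<m.
       of_bool (\<phi> x i) = b i + (\<Sum>j<n. M i j * of_bool (x j))}"

text \<open>\<open>act X m n \<phi>\<close> is the restriction \<open>X(n) \<rightarrow> X(m)\<close> along \<open>\<phi> : {0,1}\<^sup>m \<rightarrow> {0,1}\<^sup>n\<close>.\<close>

record 'a presheaf_data =
  cells :: "nat \<Rightarrow> 'a set"
  act :: "nat \<Rightarrow> nat \<Rightarrow> ((nat \<Rightarrow> bool) \<Rightarrow> (nat \<Rightarrow> bool)) \<Rightarrow> 'a \<Rightarrow> 'a"

locale cubeset =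
  fixes X :: "'a presheaf_data"
  assumes act_closed: "\<lbrakk>\<phi> \<in> box_hom m n; a \<in> cells X n\<rbrakk> \<Longrightarrow> act X m n \<phi> a \<in> cells X m"
    and act_id: "a \<in> cells X n \<Longrightarrow> act X n n (\<lambda>x\<in>cube n. x) a = a"
    and act_compose: "\<lbrakk>\<phi> \<in> box_hom l m; \<psi> \<in> box_hom m n; a \<in> cells X n\<rbrakk>
      \<Longrightarrow> act X l n (compose (cube l) \<psi> \<phi>) a = act X l m \<phi> (act X m n \<psi> a)"

definition vertices :: "'a presheaf_data \<Rightarrow> nat \<Rightarrow> 'a \<Rightarrow> (nat \<Rightarrow> bool) \<Rightarrow> 'a" where
  "vertices X n a = (\<lambda>x\<in>cube n. act X 0 n (\<lambda>_\<in>cube 0. x) a)"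

locale concrete_cubeset = cubeset +
  assumes inj_vertices: "inj_on (vertices X n) (cells X n)"

text \<open>For concrete \<open>X\<close>, this is \<open>X(n)\<close> regarded as a set of maps \<open>{0,1}\<^sup>n \<rightarrow> X(0)\<close>.\<close>

definition configs :: "'a presheaf_data \<Rightarrow> nat \<Rightarrow> ((nat \<Rightarrow> bool) \<Rightarrow> 'a) set" where
  "configs X n = vertices X n ` cells X n"

definition gluing_property :: "'a presheaf_data \<Rightarrow> bool" where
  "gluing_property X \<longleftrightarrow> (\<forall>n. \<forall>j<n. \<forall>\<epsilon>. \<forall>a\<in>configs X n. \<forall>b\<in>configs X n.
     (\<forall>x\<in>cube n. x j = \<epsilon> \<longrightarrow> a x = b x) \<longrightarrow>
     (\<lambda>x\<in>cube n. if x j then a (x(j := \<not> \<epsilon>)) else b (x(j := \<not> \<epsilon>))) \<in> configs X n)"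

definition cubeset_hom :: "'a presheaf_data \<Rightarrow> 'b presheaf_data \<Rightarrow> (nat \<Rightarrow> 'a \<Rightarrow> 'b) set" where
  "cubeset_hom Y X = {\<eta>. (\<forall>m. \<eta> m \<in> cells Y m \<rightarrow>\<^sub>E cells X m) \<and>
     (\<forall>l m. \<forall>\<phi>\<in>box_hom l m. \<forall>c\<in>cells Y m. \<eta> l (act Y l m \<phi> c) = act X l m \<phi> (\<eta> m c))}"

definition Sub :: "nat \<Rightarrow> nat set set" where
  "Sub n = {S. S \<noteq> {} \<and> S \<subseteq> {0..n}}"

definition Delta_hom :: "nat \<Rightarrow> nat \<Rightarrow> (nat \<Rightarrow> nat) set" where
  "Delta_hom k n = {\<sigma> \<in> {0..k} \<rightarrow>\<^sub>E {0..n}. mono_on {0..k} \<sigma>}"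

definition degeneracy :: "nat \<Rightarrow> nat \<Rightarrow> nat \<Rightarrow> nat" where
  "degeneracy k i = (\<lambda>j\<in>{0..k}. if j \<le> i then j else j - 1)"

definition formal_cubes :: "nat \<Rightarrow> ((nat \<Rightarrow> bool) \<Rightarrow> nat set) set" where
  "formal_cubes k = cube k \<rightarrow>\<^sub>E Sub k"

definition degenerable :: "nat \<Rightarrow> ((nat \<Rightarrow> bool) \<Rightarrow> nat set) \<Rightarrow> bool" where
  "degenerable k A \<longleftrightarrow> A \<in> formal_cubes k \<and>
     (\<forall>i<k. \<forall>x\<in>cube k. \<forall>y\<in>cube k. (\<forall>j. j \<noteq> i \<longrightarrow> x j = y j) \<longrightarrow>
        degeneracy k i ` A x = degeneracy k i ` A y)"

text \<open>\<open>prev_coord x i\<close> is \<open>x\<^bsub>i-1\<^esub>\<close>, with the convention \<open>x\<^bsub>-1\<^esub> = 1\<close>.\<close>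

definition prev_coord :: "(nat \<Rightarrow> bool) \<Rightarrow> nat \<Rightarrow> bool" where
  "prev_coord x i = (case i of 0 \<Rightarrow> True | Suc j \<Rightarrow> x j)"

text \<open>\<open>C_cube m\<close> is a formal cube only for \<open>m \<ge> 1\<close>, since \<open>C_cube 0\<close> takes the value \<open>{}\<close>.\<close>

definition C_cube :: "nat \<Rightarrow> (nat \<Rightarrow> bool) \<Rightarrow> nat set" where
  "C_cube m = (\<lambda>x\<in>cube m. {i \<in> {0..m}. x i \<or> \<not> prev_coord x i})"

definition D_cube :: "nat \<Rightarrow> (nat \<Rightarrow> bool) \<Rightarrow> nat set" where
  "D_cube m = (\<lambda>x\<in>cube m. {i \<in> {0..m}. i = m \<or> x i \<or> \<not> prev_coord x i})"

definition K_cubeset :: "nat \<Rightarrow> ((nat \<Rightarrow> bool) \<Rightarrow> nat set) presheaf_data" where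
  "K_cubeset n = \<lparr>
     cells = (\<lambda>m. {(\<lambda>x\<in>cube m. \<sigma> ` A (\<phi> x)) |k \<phi> A \<sigma>.
       \<phi> \<in> box_hom m k \<and> degenerable k A \<and> \<sigma> \<in> Delta_hom k n}),
     act = (\<lambda>l m \<phi> c. compose (cube l) c \<phi>)\<rparr>"

definition K_star :: "'a presheaf_data \<Rightarrow> nat \<Rightarrow> (nat \<Rightarrow> ((nat \<Rightarrow> bool) \<Rightarrow> nat set) \<Rightarrow> 'a) set" where
  "K_star X n = cubeset_hom (K_cubeset n) X"

text \<open>The map on \<open>0\<close>-cubes of a morphism out of \<open>K_cubeset n\<close>, read through the identification of
  \<open>Sub n\<close> with the \<open>0\<close>-cubes of \<open>K_cubeset n\<close>.\<close>

definition on_zero_cubes ::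
  "nat \<Rightarrow> (nat \<Rightarrow> ((nat \<Rightarrow> bool) \<Rightarrow> nat set) \<Rightarrow> 'a) \<Rightarrow> nat set \<Rightarrow> 'a" where
  "on_zero_cubes n \<eta> = (\<lambda>S\<in>Sub n. \<eta> 0 (\<lambda>_\<in>cube 0. S))"

definition K_cond :: "'a presheaf_data \<Rightarrow> nat \<Rightarrow> (nat set \<Rightarrow> 'a) \<Rightarrow> bool" where
  "K_cond X n f \<longleftrightarrow>
     (\<forall>m. \<forall>c\<in>cells (K_cubeset n) m. (\<lambda>x\<in>cube m. f (c x)) \<in> configs X m)"

definition C_cond :: "'a presheaf_data \<Rightarrow> nat \<Rightarrow> (nat set \<Rightarrow> 'a) \<Rightarrow> bool" where
  "C_cond X n f \<longleftrightarrow>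
     (\<forall>m\<ge>1. \<forall>\<sigma>\<in>Delta_hom m n. (\<lambda>x\<in>cube m. f (\<sigma> ` C_cube m x)) \<in> configs X m)"

definition CD_cond :: "'a presheaf_data \<Rightarrow> nat \<Rightarrow> (nat set \<Rightarrow> 'a) \<Rightarrow> bool" where
  "CD_cond X n f \<longleftrightarrow>
     (\<forall>m. \<forall>\<iota>\<in>Delta_hom m n. inj_on \<iota> {0..m} \<longrightarrow>
        (m \<ge> 1 \<longrightarrow> (\<lambda>x\<in>cube m. f (\<iota> ` C_cube m x)) \<in> configs X m) \<and>
        (\<lambda>x\<in>cube m. f (\<iota> ` D_cube m x)) \<in> configs X m)"

end

theory Submission
  imports Defs
begin

text \<open>The main point is that (c) implies (a). By gluing, the \<open>(m - 1)\<close>-configurations on the faces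
  orthogonal to a fixed axis carry an equivalence relation whose related pairs are the elements of
  \<open>X(m)\<close>, so a cube may be replaced by a chain of cubes. Each label function \<open>f\<^sub>i\<close> of a degenerable
  \<open>k\<close>-cube depends only on \<open>x\<^bsub>i-1\<^esub>\<close> and \<open>x\<^sub>i\<close>, and \<open>f\<^sub>i \<or> f\<^bsub>i+1\<^esub> = 1\<close> as soon as the cube depends on
  \<open>x\<^sub>i\<close>. Enlarging the sets on suitable faces therefore reduces a degenerable cube to cubes with larger
  values, and to cubes of lower dimension when a label is never used or \<open>\<sigma>\<close> is not injective. The
  irreducible ones have no two adjacent labels with \<open>f\<^sub>i \<noteq> 1\<close>; up to a map in the cube category they are
  the cubes with \<open>f\<^sub>i = 1\<close> for \<open>i\<close> in a set \<open>S\<close> and \<open>f\<^sub>i = x\<^sub>i \<or> \<not> x\<^bsub>i-1\<^esub>\<close> otherwise. These are glued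
  from \<open>C\<^sub>k\<close> and \<open>D\<^sub>k\<close>.\<close>

section \<open>Configurations\<close>

lemma cube_upd [simp]: "x \<in> cube k \<Longrightarrow> i < k \<Longrightarrow> x(i := v) \<in> cube k"
  by (auto simp: cube_def)

lemma finite_cube: "finite (cube k)"
proof -
  have "cube k \<subseteq> (\<lambda>S i. i \<in> S) ` Pow {..<k}"
  proof
    fix x assume "x \<in> cube k"
    then have "{i. x i} \<in> Pow {..<k}" by (auto simp: cube_def not_le[symmetric])
    moreover have "x = (\<lambda>i. i \<in> {i. x i})" by simp
    ultimately show "x \<in> (\<lambda>S i. i \<in> S) ` Pow {..<k}" by blast
  qed
  then show ?thesis by (rule finite_subset) simp
qed

text \<open>Coefficient 1 and offset 0 realise a coordinate, coefficient -1 and offset 1 its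
  negation. Affinity thus becomes a check of single coordinates.\<close>

lemma restrict_box_homI:
  assumes "\<And>x. x \<in> cube m \<Longrightarrow> \<phi> x \<in> cube n"
    and "\<And>i. i < n \<Longrightarrow> (\<exists>b. \<forall>x\<in>cube m. \<phi> x i = b) \<or> (\<exists>j<m. \<exists>b. \<forall>x\<in>cube m. \<phi> x i = (x j = b))"
  shows "restrict \<phi> (cube m) \<in> box_hom m n"
proof -
  have "\<exists>p :: (nat \<Rightarrow> int) \<times> int. \<forall>x\<in>cube m.
      of_bool (\<phi> x i) = snd p + (\<Sum>j<m. fst p j * of_bool (x j))" if "i < n" for i
    using assms(2)[OF that]
  proof (elim disjE exE conjE)
    fix b assume "\<forall>x\<in>cube m. \<phi> x i = b"
    then show ?thesis by (intro exI[of _ "(\<lambda>_. 0, of_bool b)"]) simp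
  next
    fix j b assume j: "j < m" "\<forall>x\<in>cube m. \<phi> x i = (x j = b)"
    let ?c = "if b then 1 else - 1 :: int"
    have "(\<Sum>j'<m. (if j' = j then ?c else 0) * of_bool (x j')) = ?c * of_bool (x j)" for x :: "nat \<Rightarrow> bool"
    proof -
      have "(\<Sum>j'<m. (if j' = j then ?c else 0) * of_bool (x j')) =
          (\<Sum>j'<m. if j' = j then ?c * of_bool (x j) else 0)" by (rule sum.cong) auto
      then show ?thesis using j by simp
    qed
    then show ?thesis using j
      by (intro exI[of _ "(\<lambda>j'. if j' = j then ?c else 0, of_bool (\<not> b))"]) (auto simp: of_bool_def)
  qed
  then have "\<forall>i. \<exists>p :: (nat \<Rightarrow> int) \<times> int. i < n \<longrightarrow> (\<forall>x\<in>cube m.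
      of_bool (\<phi> x i) = snd p + (\<Sum>j<m. fst p j * of_bool (x j)))" by blast
  then obtain p :: "nat \<Rightarrow> (nat \<Rightarrow> int) \<times> int" where p: "\<And>i. i < n \<Longrightarrow> \<forall>x\<in>cube m.
      of_bool (\<phi> x i) = snd (p i) + (\<Sum>j<m. fst (p i) j * of_bool (x j))"
    by metis
  then show ?thesis using assms(1) unfolding box_hom_def
    by (auto intro!: exI[of _ "\<lambda>i. fst (p i)"] exI[of _ "\<lambda>i. snd (p i)"])
qed

lemma box_hom_cube: "\<phi> \<in> box_hom m n \<Longrightarrow> x \<in> cube m \<Longrightarrow> \<phi> x \<in> cube n"
  by (auto simp: box_hom_def)

lemma const_box_hom: "x \<in> cube n \<Longrightarrow> (\<lambda>_\<in>cube m. x) \<in> box_hom m n"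
  by (rule restrict_box_homI) auto

lemma id_box_hom: "(\<lambda>x\<in>cube m. x) \<in> box_hom m m"
proof (rule restrict_box_homI)
  fix i assume "i < m"
  then show "(\<exists>b. \<forall>x\<in>cube m. x i = b) \<or> (\<exists>j<m. \<exists>b. \<forall>x\<in>cube m. x i = (x j = b))"
    by (intro disjI2 exI[of _ i] conjI exI[of _ True]) auto
qed

lemma compose_box_hom:
  assumes "\<phi> \<in> box_hom l m" "\<psi> \<in> box_hom m n"
  shows "compose (cube l) \<psi> \<phi> \<in> box_hom l n"
proof -
  from assms(1) obtain M :: "nat \<Rightarrow> nat \<Rightarrow> int" and b :: "nat \<Rightarrow> int" where
    M: "\<And>x i. x \<in> cube l \<Longrightarrow> i < m \<Longrightarrow> of_bool (\<phi> x i) = b i + (\<Sum>j<l. M i j * of_bool (x j))"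
    unfolding box_hom_def by blast
  from assms(2) obtain N :: "nat \<Rightarrow> nat \<Rightarrow> int" and c :: "nat \<Rightarrow> int" where
    N: "\<And>x i. x \<in> cube m \<Longrightarrow> i < n \<Longrightarrow> of_bool (\<psi> x i) = c i + (\<Sum>j<m. N i j * of_bool (x j))"
    unfolding box_hom_def by blast
  have "of_bool (\<psi> (\<phi> x) i) = (c i + (\<Sum>j<m. N i j * b j))
      + (\<Sum>h<l. (\<Sum>j<m. N i j * M j h) * of_bool (x h))"
    if "x \<in> cube l" "i < n" for x i
  proof -
    have "of_bool (\<psi> (\<phi> x) i) = c i + (\<Sum>j<m. N i j * of_bool (\<phi> x j))"
      using N that box_hom_cube[OF assms(1)] by blast
    also have "\<dots> = c i + (\<Sum>j<m. N i j * (b j + (\<Sum>h<l. M j h * of_bool (x h))))"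
      using M that by simp
    also have "\<dots> = c i + (\<Sum>j<m. N i j * b j) + (\<Sum>j<m. \<Sum>h<l. N i j * M j h * of_bool (x h))"
      by (simp only: distrib_left sum.distrib sum_distrib_left mult.assoc add.assoc)
    also have "(\<Sum>j<m. \<Sum>h<l. N i j * M j h * of_bool (x h)) =
        (\<Sum>h<l. (\<Sum>j<m. N i j * M j h) * of_bool (x h))"
      by (subst sum.swap) (simp only: sum_distrib_right)
    finally show ?thesis .
  qed
  then show ?thesis
    using assms box_hom_cube[OF assms(2) box_hom_cube[OF assms(1)]] unfolding box_hom_def
    by (auto simp: compose_def intro!: exI[of _ "\<lambda>i h. \<Sum>j<m. N i j * M j h"]
        exI[of _ "\<lambda>i. c i + (\<Sum>j<m. N i j * b j)"])
qed

section \<open>Configurations and their pullbacks\<close>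

context cubeset begin

lemma vertices_act:
  assumes "\<phi> \<in> box_hom m n" "a \<in> cells X n"
  shows "vertices X m (act X m n \<phi> a) = (\<lambda>x\<in>cube m. vertices X n a (\<phi> x))"
proof -
  have "act X 0 m (\<lambda>_\<in>cube 0. x) (act X m n \<phi> a) = act X 0 n (\<lambda>_\<in>cube 0. \<phi> x) a"
    if "x \<in> cube m" for x
  proof -
    have "compose (cube 0) \<phi> (\<lambda>_\<in>cube 0. x) = (\<lambda>_\<in>cube 0. \<phi> x)"
      by (auto simp: compose_def)
    then show ?thesis using act_compose[OF const_box_hom[OF that, of 0] assms] by simp
  qed
  then show ?thesis using box_hom_cube[OF assms(1)] by (auto simp: vertices_def)
qed

lemma vertices_0: "a \<in> cells X 0 \<Longrightarrow> vertices X 0 a = (\<lambda>_\<in>cube 0. a)"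
proof -
  assume a: "a \<in> cells X 0"
  have "(\<lambda>_\<in>cube 0. x) = (\<lambda>x\<in>cube 0. x)" if "x \<in> cube 0" for x
    using that by (auto simp: cube_def fun_eq_iff)
  then show ?thesis using act_id[OF a] by (auto simp: vertices_def)
qed

text \<open>Restricting first lets \<open>u\<close> be any lambda term, with arbitrary values off
  the cube.\<close>

definition conf :: "nat \<Rightarrow> ((nat \<Rightarrow> bool) \<Rightarrow> 'a) \<Rightarrow> bool" where
  "conf m u \<longleftrightarrow> restrict u (cube m) \<in> configs X m"

lemma conf_cong: "(\<And>x. x \<in> cube m \<Longrightarrow> u x = v x) \<Longrightarrow> conf m u \<longleftrightarrow> conf m v"
  unfolding conf_def by (simp cong: restrict_cong)

lemma conf_eqI: "conf m u \<Longrightarrow> (\<And>x. x \<in> cube m \<Longrightarrow> u x = v x) \<Longrightarrow> conf m v"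
  using conf_cong by blast

lemma conf_box_hom:
  assumes "conf n u" "\<phi> \<in> box_hom m n"
  shows "conf m (\<lambda>x. u (\<phi> x))"
proof -
  obtain a where a: "a \<in> cells X n" "restrict u (cube n) = vertices X n a"
    using assms(1) by (auto simp: conf_def configs_def)
  have "(\<lambda>x\<in>cube m. u (\<phi> x)) = (\<lambda>x\<in>cube m. restrict u (cube n) (\<phi> x))"
    using box_hom_cube[OF assms(2)] by auto
  also have "\<dots> = vertices X m (act X m n \<phi> a)"
    using vertices_act[OF assms(2) a(1)] a(2) by simp
  finally show ?thesis using act_closed[OF assms(2) a(1)] by (auto simp: conf_def configs_def)
qed

lemma conf_reindex:
  assumes "conf n u" "\<And>x. x \<in> cube m \<Longrightarrow> \<phi> x \<in> cube n"
    and "\<And>i. i < n \<Longrightarrow> (\<exists>b. \<forall>x\<in>cube m. \<phi> x i = b) \<or> (\<exists>j<m. \<exists>b. \<forall>x\<in>cube m. \<phi> x i = (x j = b))"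
  shows "conf m (\<lambda>x. u (\<phi> x))"
proof -
  have "conf m (\<lambda>x. u (restrict \<phi> (cube m) x))"
    by (intro conf_box_hom[OF assms(1)] restrict_box_homI assms)
  then show ?thesis by (subst conf_cong[where v = "\<lambda>x. u (restrict \<phi> (cube m) x)"]) auto
qed

lemma conf_flip:
  assumes "conf m u" "j < m"
  shows "conf m (\<lambda>x. u (x(j := \<not> x j)))"
proof (rule conf_reindex[OF assms(1)])
  fix i assume "i < m"
  then show "(\<exists>b. \<forall>x\<in>cube m. (x(j := \<not> x j)) i = b) \<or>
      (\<exists>j'<m. \<exists>b. \<forall>x\<in>cube m. (x(j := \<not> x j)) i = (x j' = b))"
    by (intro disjI2 exI[of _ i] conjI exI[of _ "i \<noteq> j"]) auto
qed (use assms in auto)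

end

section \<open>Gluing as an equivalence relation on faces\<close>

locale gluing_cubeset = concrete_cubeset +
  assumes gluing: "gluing_property X"
begin

text \<open>Gluing along the face x_j = 0: the faces x_j = 1 of \<open>u\<close> and
  \<open>v\<close> become the two ends of the new cube.\<close>

lemma conf_glue:
  assumes "conf m u" "conf m v" "j < m"
    and "\<And>x. x \<in> cube m \<Longrightarrow> \<not> x j \<Longrightarrow> u x = v x"
  shows "conf m (\<lambda>x. if x j then u (x(j := True)) else v (x(j := True)))"
proof -
  have "(\<lambda>x\<in>cube m. if x j then restrict u (cube m) (x(j := \<not> False))
      else restrict v (cube m) (x(j := \<not> False))) \<in> configs X m"
    using gluing assms unfolding gluing_property_def conf_def by auto
  also have "(\<lambda>x\<in>cube m. if x j then restrict u (cube m) (x(j := \<not> False))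
      else restrict v (cube m) (x(j := \<not> False))) =
      (\<lambda>x\<in>cube m. if x j then u (x(j := True)) else v (x(j := True)))"
    using assms(3) by (intro restrict_ext) auto
  finally show ?thesis unfolding conf_def .
qed

text \<open>By gluing and reflection, the following is an equivalence relation between the
  \<open>(m - 1)\<close>-configurations on the faces orthogonal to the \<open>j\<close>-th axis.\<close>

definition conf_rel ::
  "nat \<Rightarrow> nat \<Rightarrow> ((nat \<Rightarrow> bool) \<Rightarrow> 'a) \<Rightarrow> ((nat \<Rightarrow> bool) \<Rightarrow> 'a) \<Rightarrow> bool" where
  "conf_rel m j u v \<longleftrightarrow> conf m (\<lambda>x. if x j then u (x(j := False)) else v (x(j := False)))"

lemma conf_rel_sym:
  assumes "j < m" "conf_rel m j u v"
  shows "conf_rel m j v u"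
  using conf_flip[OF assms(2)[unfolded conf_rel_def] assms(1)] unfolding conf_rel_def
  by (subst conf_cong) (auto split: if_splits)

text \<open>The cubes joining \<open>u\<close> to \<open>v\<close> and \<open>w\<close> to
  \<open>v\<close> share the face \<open>v\<close>; gluing along it leaves \<open>u\<close> and
  \<open>w\<close>.\<close>

lemma conf_rel_trans:
  assumes "j < m" "conf_rel m j u v" "conf_rel m j v w"
  shows "conf_rel m j u w"
proof -
  have "conf m (\<lambda>x. if x j then
      (if (x(j := True)) j then u (x(j := True, j := False)) else v (x(j := True, j := False)))
      else (if (x(j := True)) j then w (x(j := True, j := False)) else v (x(j := True, j := False))))"
    using conf_glue[OF assms(2)[unfolded conf_rel_def]
        conf_rel_sym[OF assms(1,3), unfolded conf_rel_def] assms(1)] by simp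
  then show ?thesis by (simp only: conf_rel_def fun_upd_same fun_upd_upd if_True)
qed

lemma conf_rel_faces_iff:
  assumes "j < m"
  shows "conf_rel m j (\<lambda>x. u (x(j := \<epsilon>))) (\<lambda>x. u (x(j := \<not> \<epsilon>))) \<longleftrightarrow> conf m u"
proof -
  have *: "conf_rel m j (\<lambda>x. u (x(j := True))) (\<lambda>x. u (x(j := False))) \<longleftrightarrow> conf m u"
    unfolding conf_rel_def by (rule conf_cong) (simp add: fun_upd_idem)
  then show ?thesis using conf_rel_sym[OF assms] by (cases \<epsilon>) auto
qed

end


section \<open>Degenerable formal cubes\<close>

text \<open>\<open>mrg i\<close> and \<open>skp i\<close> are the degeneracy \<open>\<sigma>\<^sub>i\<close> and the coface \<open>\<delta>\<^sub>i\<close>, in all dimensions at once.\<close>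

definition mrg :: "nat \<Rightarrow> nat \<Rightarrow> nat" where
  "mrg i j = (if j \<le> i then j else j - 1)"

definition skp :: "nat \<Rightarrow> nat \<Rightarrow> nat" where
  "skp i j = (if j < i then j else Suc j)"

section \<open>Direct images, faces and projections\<close>

lemma mem_mrg_image:
  "l \<in> mrg i ` S \<longleftrightarrow> l < i \<and> l \<in> S \<or> l = i \<and> (i \<in> S \<or> Suc i \<in> S) \<or> i < l \<and> Suc l \<in> S"
proof
  assume "l < i \<and> l \<in> S \<or> l = i \<and> (i \<in> S \<or> Suc i \<in> S) \<or> i < l \<and> Suc l \<in> S"
  moreover have "mrg i (Suc l) = l" if "i \<le> l" using that by (simp add: mrg_def)
  moreover have "mrg i l = l" if "l \<le> i" using that by (simp add: mrg_def)
  ultimately show "l \<in> mrg i ` S" by (metis image_eqI le_refl less_imp_le)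
next
  assume "l \<in> mrg i ` S"
  then obtain j where j: "j \<in> S" "l = mrg i j" by blast
  consider "j \<le> i" | "j = Suc i" | "Suc i < j" by linarith
  then show "l < i \<and> l \<in> S \<or> l = i \<and> (i \<in> S \<or> Suc i \<in> S) \<or> i < l \<and> Suc l \<in> S"
    using j by cases (auto simp: mrg_def le_less)
qed

text \<open>The direct image keeps all labels but \<open>i\<close> and \<open>i + 1\<close>, of
  which it only records whether one is present. This turns degenerability into a property of label
  functions.\<close>

lemma mrg_image_eq_iff:
  "mrg i ` S = mrg i ` T \<longleftrightarrow>
    (\<forall>l. l \<noteq> i \<and> l \<noteq> Suc i \<longrightarrow> (l \<in> S \<longleftrightarrow> l \<in> T)) \<and> (i \<in> S \<or> Suc i \<in> S \<longleftrightarrow> i \<in> T \<or> Suc i \<in> T)"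
    (is "?L \<longleftrightarrow> ?R")
proof
  assume L: ?L
  have "l \<in> S \<longleftrightarrow> l \<in> T" if l: "l \<noteq> i \<and> l \<noteq> Suc i" for l
  proof (cases "l < i")
    case True
    then show ?thesis using L mem_mrg_image[of l i S] mem_mrg_image[of l i T] by auto
  next
    case False
    then obtain l' where "l = Suc l'" "i < l'" using l by (cases l) auto
    then show ?thesis using L mem_mrg_image[of l' i S] mem_mrg_image[of l' i T] by auto
  qed
  then show ?R using L mem_mrg_image[of i i S] mem_mrg_image[of i i T] by auto
next
  assume ?R
  then have "l \<in> mrg i ` S \<longleftrightarrow> l \<in> mrg i ` T" for l
    unfolding mem_mrg_image by (cases l i rule: linorder_cases) simp_all
  then show ?L by blast
qed

text \<open>\<open>skp i\<close> is the section of \<open>mrg i\<close> that misses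
  \<open>i\<close>, so the composite fixes every other label.\<close>

lemma skp_mrg_image: "i \<notin> S \<Longrightarrow> skp i ` mrg i ` S = S"
proof -
  assume "i \<notin> S"
  then have "skp i (mrg i j) = j" if "j \<in> S" for j
    using that by (cases "j = i") (auto simp: skp_def mrg_def)
  then have "skp i ` mrg i ` S = (\<lambda>j. j) ` S"
    unfolding image_image by (intro image_cong) auto
  then show ?thesis by simp
qed

text \<open>The inclusion of the face x_i = 0; \<open>drp\<close> is the projection forgetting x_i.
  Coordinates are renumbered by \<open>skp i\<close>, just as labels are.\<close>

definition ins :: "nat \<Rightarrow> (nat \<Rightarrow> bool) \<Rightarrow> nat \<Rightarrow> bool" where
  "ins i x = (\<lambda>j. if j < i then x j else if j = i then False else x (j - 1))"

definition drp :: "nat \<Rightarrow> (nat \<Rightarrow> bool) \<Rightarrow> nat \<Rightarrow> bool" where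
  "drp i x = (\<lambda>j. x (skp i j))"

lemma ins_cube: "x \<in> cube k \<Longrightarrow> i \<le> k \<Longrightarrow> ins i x \<in> cube (Suc k)"
  by (auto simp: cube_def ins_def)

lemma drp_cube: "x \<in> cube (Suc k) \<Longrightarrow> i \<le> k \<Longrightarrow> drp i x \<in> cube k"
  by (auto simp: cube_def drp_def skp_def)

lemma ins_drp: "ins i (drp i x) = x(i := False)"
  by (auto simp: ins_def drp_def skp_def fun_eq_iff)

lemma ins_upd: "ins i (x(l := v)) = (ins i x)(skp i l := v)"
  by (auto simp: ins_def skp_def fun_eq_iff)

text \<open>Degenerability freed from extensionality and from the dimension in
  \<open>degeneracy\<close>, so that cubes can be written as plain lambda terms.\<close>

definition degen :: "nat \<Rightarrow> ((nat \<Rightarrow> bool) \<Rightarrow> nat set) \<Rightarrow> bool" where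
  "degen k A \<longleftrightarrow> (\<forall>x\<in>cube k. A x \<in> Sub k) \<and>
    (\<forall>i<k. \<forall>x\<in>cube k. \<forall>v. mrg i ` A (x(i := v)) = mrg i ` A x)"

lemma degenerable_iff: "degenerable k A \<longleftrightarrow> A \<in> extensional (cube k) \<and> degen k A"
proof -
  have deg: "degeneracy k i ` S = mrg i ` S" if "S \<in> Sub k" for i S
    using that by (intro image_cong) (auto simp: degeneracy_def mrg_def Sub_def)
  have upd: "y = x(i := y i)" if "\<forall>j. j \<noteq> i \<longrightarrow> x j = y j" for x y :: "nat \<Rightarrow> bool" and i
    using that by (simp add: fun_eq_iff)
  show ?thesis
  proof
    assume D: "degenerable k A"
    then have PiE: "A \<in> cube k \<rightarrow>\<^sub>E Sub k"
      and eq: "\<And>i x y. \<lbrakk>i < k; x \<in> cube k; y \<in> cube k; \<forall>j. j \<noteq> i \<longrightarrow> x j = y j\<rbrakk>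
        \<Longrightarrow> degeneracy k i ` A x = degeneracy k i ` A y"
      unfolding degenerable_def formal_cubes_def by blast+
    have "mrg i ` A (x(i := v)) = mrg i ` A x" if "i < k" "x \<in> cube k" for i x v
    proof -
      have x': "x(i := v) \<in> cube k" using that by simp
      have "degeneracy k i ` A (x(i := v)) = degeneracy k i ` A x"
        using that by (intro eq x') auto
      then show ?thesis using deg[OF PiE_mem[OF PiE]] x' that(2) by metis
    qed
    then have "degen k A" unfolding degen_def using PiE_mem[OF PiE] by blast
    then show "A \<in> extensional (cube k) \<and> degen k A" using PiE by (simp add: PiE_def)
  next
    assume D: "A \<in> extensional (cube k) \<and> degen k A"
    then have sub: "\<And>x. x \<in> cube k \<Longrightarrow> A x \<in> Sub k"
      and eq: "\<And>i x v. \<lbrakk>i < k; x \<in> cube k\<rbrakk> \<Longrightarrow> mrg i ` A (x(i := v)) = mrg i ` A x"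
      unfolding degen_def by blast+
    have "degeneracy k i ` A x = degeneracy k i ` A y"
      if "i < k" "x \<in> cube k" "y \<in> cube k" "\<forall>j. j \<noteq> i \<longrightarrow> x j = y j" for i x y
    proof -
      have "mrg i ` A x = mrg i ` A y" using eq[OF that(1,2), of "y i"] arg_cong[OF upd[OF that(4)], of A]
        by (simp only:)
      then show ?thesis using that(2,3) deg sub by simp
    qed
    moreover have "A \<in> formal_cubes k" unfolding formal_cubes_def using sub D by (auto simp: PiE_def)
    ultimately show "degenerable k A" unfolding degenerable_def by blast
  qed
qed

section \<open>Label functions of degenerable cubes\<close>

lemma degen_Sub: "degen k A \<Longrightarrow> x \<in> cube k \<Longrightarrow> A x \<in> Sub k"
  by (simp add: degen_def)

lemma degen_le: "degen k A \<Longrightarrow> x \<in> cube k \<Longrightarrow> l \<in> A x \<Longrightarrow> l \<le> k"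
  by (drule (1) degen_Sub) (auto simp: Sub_def)

lemma degen_other:
  "degen k A \<Longrightarrow> x \<in> cube k \<Longrightarrow> i < k \<Longrightarrow> l \<noteq> i \<Longrightarrow> l \<noteq> Suc i \<Longrightarrow> l \<in> A (x(i := v)) \<longleftrightarrow> l \<in> A x"
  unfolding degen_def mrg_image_eq_iff by blast

lemma degen_pair:
  "degen k A \<Longrightarrow> x \<in> cube k \<Longrightarrow> i < k \<Longrightarrow>
    i \<in> A (x(i := v)) \<or> Suc i \<in> A (x(i := v)) \<longleftrightarrow> i \<in> A x \<or> Suc i \<in> A x"
  unfolding degen_def mrg_image_eq_iff by blast

lemma degenI:
  assumes "\<And>x. x \<in> cube k \<Longrightarrow> A x \<noteq> {}"
    and "\<And>x l. x \<in> cube k \<Longrightarrow> l \<in> A x \<Longrightarrow> l \<le> k"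
    and "\<And>x i v l. x \<in> cube k \<Longrightarrow> i < k \<Longrightarrow> l \<noteq> i \<Longrightarrow> l \<noteq> Suc i \<Longrightarrow> l \<in> A (x(i := v)) \<longleftrightarrow> l \<in> A x"
    and "\<And>x i v. x \<in> cube k \<Longrightarrow> i < k \<Longrightarrow>
      i \<in> A (x(i := v)) \<or> Suc i \<in> A (x(i := v)) \<longleftrightarrow> i \<in> A x \<or> Suc i \<in> A x"
  shows "degen k A"
  unfolding degen_def mrg_image_eq_iff using assms by (auto simp: Sub_def)

lemma degen_face:
  assumes "degen k A" "i < k"
  shows "degen k (\<lambda>x. A (x(i := \<epsilon>)))"
proof (rule degenI)
  fix x j v l
  assume x: "x \<in> cube k" "j < k"
  then have y: "x(i := \<epsilon>) \<in> cube k" using assms by simp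
  have upd: "x(j := v, i := \<epsilon>) = (if j = i then x(i := \<epsilon>) else x(i := \<epsilon>, j := v))"
    by (simp add: fun_upd_twist)
  show "l \<in> A (x(j := v, i := \<epsilon>)) \<longleftrightarrow> l \<in> A (x(i := \<epsilon>))" if "l \<noteq> j" "l \<noteq> Suc j"
    using degen_other[OF assms(1) y x(2) that] unfolding upd by simp
  show "j \<in> A (x(j := v, i := \<epsilon>)) \<or> Suc j \<in> A (x(j := v, i := \<epsilon>)) \<longleftrightarrow>
      j \<in> A (x(i := \<epsilon>)) \<or> Suc j \<in> A (x(i := \<epsilon>))"
    using degen_pair[OF assms(1) y x(2)] unfolding upd by simp
next
  fix x l assume "x \<in> cube k" "l \<in> A (x(i := \<epsilon>))"
  then show "l \<le> k" using degen_le[OF assms(1) cube_upd[OF _ assms(2)]] by blast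
qed (use degen_Sub[OF assms(1)] assms(2) in \<open>auto simp: Sub_def\<close>)

lemma degen_Un_const:
  assumes "degen k A" "L \<subseteq> {0..k}"
  shows "degen k (\<lambda>x. A x \<union> L)"
proof (rule degenI)
  fix x i v l
  assume x: "x \<in> cube k" "i < k"
  show "l \<in> A (x(i := v)) \<union> L \<longleftrightarrow> l \<in> A x \<union> L" if "l \<noteq> i" "l \<noteq> Suc i"
    using degen_other[OF assms(1) x that] by simp
  show "i \<in> A (x(i := v)) \<union> L \<or> Suc i \<in> A (x(i := v)) \<union> L \<longleftrightarrow> i \<in> A x \<union> L \<or> Suc i \<in> A x \<union> L"
    using degen_pair[OF assms(1) x] by auto
qed (use degen_Sub[OF assms(1)] assms(2) in \<open>auto simp: Sub_def subset_iff\<close>)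

text \<open>The disjunction of the labels \<open>i\<close> and \<open>i + 1\<close> is 1 before and
  after, and the added part varies with x_i only.\<close>

lemma degen_Un_face:
  assumes "degen k A" "i < k" "L \<subseteq> {i, Suc i}"
    and full: "\<And>x. x \<in> cube k \<Longrightarrow> i \<in> A x \<or> Suc i \<in> A x"
  shows "degen k (\<lambda>x. A x \<union> (if x i = \<epsilon> then L else {}))"
proof (rule degenI)
  fix x j v l
  assume x: "x \<in> cube k" "j < k"
  show "l \<in> A (x(j := v)) \<union> (if (x(j := v)) i = \<epsilon> then L else {}) \<longleftrightarrow>
      l \<in> A x \<union> (if x i = \<epsilon> then L else {})" if "l \<noteq> j" "l \<noteq> Suc j"
    using degen_other[OF assms(1) x that] assms(3) that by auto
  show "j \<in> A (x(j := v)) \<union> (if (x(j := v)) i = \<epsilon> then L else {}) \<or>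
        Suc j \<in> A (x(j := v)) \<union> (if (x(j := v)) i = \<epsilon> then L else {}) \<longleftrightarrow>
      j \<in> A x \<union> (if x i = \<epsilon> then L else {}) \<or> Suc j \<in> A x \<union> (if x i = \<epsilon> then L else {})"
  proof (cases "j = i")
    case True
    then show ?thesis using full[of x] full[of "x(j := v)"] x by auto
  next
    case False
    then show ?thesis using degen_pair[OF assms(1) x, of v] by auto
  qed
next
  fix x l assume "x \<in> cube k" "l \<in> A x \<union> (if x i = \<epsilon> then L else {})"
  then show "l \<le> k" using degen_le[OF assms(1)] assms(2,3) by (auto split: if_splits)
qed (use degen_Sub[OF assms(1)] in \<open>auto simp: Sub_def\<close>)

lemma degen_mrg:
  assumes "degen (Suc k) A" "i \<le> k"
  shows "degen k (\<lambda>x. mrg i ` A (ins i x))"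
  unfolding degen_def
proof (intro conjI ballI allI impI)
  fix x assume "x \<in> cube k"
  then have "A (ins i x) \<in> Sub (Suc k)" using degen_Sub[OF assms(1)] ins_cube assms(2) by auto
  then show "mrg i ` A (ins i x) \<in> Sub k" using assms(2) by (auto simp: Sub_def mrg_def subset_iff)
next
  fix l x v assume l: "l < k" and x: "x \<in> cube k"
  have eq: "mrg (skp i l) ` A ((ins i x)(skp i l := v)) = mrg (skp i l) ` A (ins i x)"
    using assms(1) ins_cube[OF x assms(2)] l unfolding degen_def by (auto simp: skp_def)
  \<comment> \<open>The simplicial identity for two degeneracies; coordinate \<open>l\<close> of the
    smaller cube is coordinate \<open>skp i l\<close> of the larger one.\<close>
  have comm: "mrg l (mrg i j) = mrg (if l < i then i - 1 else i) (mrg (skp i l) j)" for j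
    by (auto simp: mrg_def skp_def)
  have "mrg l ` mrg i ` S = mrg (if l < i then i - 1 else i) ` mrg (skp i l) ` S" for S
    by (simp only: image_image comm)
  then show "mrg l ` mrg i ` A (ins i (x(l := v))) = mrg l ` mrg i ` A (ins i x)"
    by (simp only: ins_upd eq)
qed

text \<open>Merging \<open>i\<close> and \<open>i + 1\<close> removes the dependence on x_i, so the
  merged cube is a pullback along \<open>drp i\<close>.\<close>

lemma mrg_ins_drp:
  assumes "degen (Suc k) A" "i \<le> k" "x \<in> cube (Suc k)"
  shows "mrg i ` A (ins i (drp i x)) = mrg i ` A x"
  using assms unfolding ins_drp degen_def by auto

lemma cube_invariant_eq:
  assumes "finite I" "I \<subseteq> {..<k}"
    and "\<And>x i v. x \<in> cube k \<Longrightarrow> i \<in> I \<Longrightarrow> P (x(i := v)) = P x"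
    and "x \<in> cube k" "y \<in> cube k" "\<And>i. i \<notin> I \<Longrightarrow> x i = y i"
  shows "P x = P y"
  using assms
proof (induction I arbitrary: x rule: finite_induct)
  case empty
  then have "x = y" by auto
  then show ?case by simp
next
  case (insert i I)
  have "P (x(i := y i)) = P y"
  proof (rule insert.IH)
    show "x(i := y i) \<in> cube k" using insert.prems(1,3) by simp
    show "(x(i := y i)) j = y j" if "j \<notin> I" for j
      using insert.prems(5)[of j] that by (cases "j = i") auto
  qed (use insert.prems in auto)
  then show ?case using insert.prems(2,3) by simp
qed

lemma degen_label:
  assumes "degen k A" "x \<in> cube k" "y \<in> cube k" "x l = y l" "prev_coord x l = prev_coord y l"
  shows "l \<in> A x \<longleftrightarrow> l \<in> A y"
proof (rule cube_invariant_eq[where P = "\<lambda>x. l \<in> A x" and I = "{i. i < k \<and> l \<noteq> i \<and> l \<noteq> Suc i}"])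
  \<comment> \<open>A coordinate left out of the index set is \<open>l\<close>, its predecessor, or
    at least \<open>k\<close>, where both points are padded with 0.\<close>
  fix i assume "i \<notin> {i. i < k \<and> l \<noteq> i \<and> l \<noteq> Suc i}"
  then show "x i = y i" using assms by (auto simp: cube_def prev_coord_def split: nat.splits)
next
  fix x i v assume "x \<in> cube k" "i \<in> {i. i < k \<and> l \<noteq> i \<and> l \<noteq> Suc i}"
  then show "(l \<in> A (x(i := v))) = (l \<in> A x)" using degen_other[OF assms(1)] by blast
qed (use assms(2,3) in auto)

definition depends :: "((nat \<Rightarrow> bool) \<Rightarrow> nat set) \<Rightarrow> nat \<Rightarrow> nat \<Rightarrow> bool" where
  "depends A k i \<longleftrightarrow> (\<exists>x\<in>cube k. \<exists>v. A (x(i := v)) \<noteq> A x)"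

text \<open>The labels \<open>i\<close> and \<open>i + 1\<close> share only the coordinate x_i. If
  one of them varies with x_i and both are absent somewhere, a spliced point has neither, while
  flipping its x_i brings one back; this contradicts the invariance of their disjunction.\<close>

lemma depends_full:
  assumes "degen k A" "i < k" "depends A k i" "x \<in> cube k"
  shows "i \<in> A x \<or> Suc i \<in> A x"
proof (rule ccontr)
  assume neg: "\<not> (i \<in> A x \<or> Suc i \<in> A x)"
  obtain z v where z: "z \<in> cube k" and "A (z(i := v)) \<noteq> A z"
    using assms(3) unfolding depends_def by blast
  then obtain l where l: "(l \<in> A (z(i := v))) \<noteq> (l \<in> A z)" unfolding set_eq_iff by metis
  have li: "l = i \<or> l = Suc i" using degen_other[OF assms(1) z assms(2), of l v] l by argo
  have "z i \<noteq> v" using l fun_upd_idem[of z i v] by metis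
  then have "z(i := \<not> v) = z" by (intro fun_upd_idem) simp
  then have "(l \<in> A (z(i := v))) \<noteq> (l \<in> A (z(i := \<not> v)))" using l by (simp only: simp_thms)
  then obtain w where w: "l \<notin> A (z(i := w))" "l \<in> A (z(i := \<not> w))"
    by (cases "l \<in> A (z(i := v))") (use that[of "\<not> v"] that[of v] in simp_all)
  \<comment> \<open>The splice copies \<open>z\<close> on the side of \<open>i\<close> seen by the
    varying label \<open>l\<close>, and \<open>x\<close> on the side seen by the other label
    \<open>l'\<close>.\<close>
  define y where "y v = (\<lambda>j. if j = i then v else if (l = i) = (j < i) then z j else x j)" for v
  define l' where "l' = (if l = i then Suc i else i)"
  have y: "y v \<in> cube k" for v using z(1) assms(2,4) by (auto simp: cube_def y_def)
  have lab: "l \<in> A (y v) \<longleftrightarrow> l \<in> A (z(i := v))" for v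
  proof (rule degen_label[OF assms(1) y])
    show "prev_coord (y v) l = prev_coord (z(i := v)) l"
      using li by (auto simp: y_def prev_coord_def split: nat.splits)
  qed (use z assms(2) li in \<open>auto simp: y_def\<close>)
  have "l' \<in> A (y w) \<longleftrightarrow> l' \<in> A (x(i := w))"
  proof (rule degen_label[OF assms(1) y])
    show "prev_coord (y w) l' = prev_coord (x(i := w)) l'"
      using li by (auto simp: y_def l'_def prev_coord_def split: nat.splits)
  qed (use assms(2,4) li in \<open>auto simp: y_def l'_def\<close>)
  moreover have "l' \<notin> A (x(i := w))"
    using degen_pair[OF assms(1,4,2), of w] neg by (auto simp: l'_def)
  ultimately have "\<not> (i \<in> A (y w) \<or> Suc i \<in> A (y w))"
    using lab[of w] w(1) li by (auto simp: l'_def split: if_splits)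
  moreover have "y (\<not> w) = (y w)(i := \<not> w)" by (simp add: y_def fun_eq_iff)
  moreover have "i \<in> A (y (\<not> w)) \<or> Suc i \<in> A (y (\<not> w))" using lab[of "\<not> w"] w(2) li by metis
  ultimately show False using degen_pair[OF assms(1) y[of w] assms(2), of "\<not> w"] by simp
qed


section \<open>Configurations on degenerable cubes\<close>

lemma prev_coord_upd: "l \<noteq> Suc i \<Longrightarrow> prev_coord (x(i := v)) l = prev_coord x l"
  by (auto simp: prev_coord_def split: nat.splits)

lemma prev_coord_0 [simp]: "prev_coord x 0"
  by (simp add: prev_coord_def)

lemma prev_coord_Suc [simp]: "prev_coord x (Suc i) = x i"
  by (simp add: prev_coord_def)

text \<open>\<open>E_cube k S\<close> interpolates between \<open>C\<^sub>k\<close>, for \<open>S = {}\<close>, and \<open>D\<^sub>k\<close>, for \<open>S = {k}\<close>.\<close>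

definition E_cube :: "nat \<Rightarrow> nat set \<Rightarrow> (nat \<Rightarrow> bool) \<Rightarrow> nat set" where
  "E_cube k S x = {i \<in> {0..k}. i \<in> S \<or> x i \<or> \<not> prev_coord x i}"

context gluing_cubeset begin

text \<open>Induction on the total distance of \<open>S\<close> from \<open>k + 1\<close>. Unless
  \<open>S\<close> is empty or \<open>{k}\<close>, its least label \<open>i\<close> is dropped or
  moved to \<open>i + 1\<close>. Both moves decrease the sum, and the two resulting cubes are glued
  along their common face x_i = 0.\<close>

lemma conf_E_cube:
  assumes C: "k \<ge> 1 \<Longrightarrow> conf k (\<lambda>x. g (C_cube k x))"
    and D: "conf k (\<lambda>x. g (D_cube k x))"
    and "S \<subseteq> {0..k}" "S \<noteq> {} \<or> k \<ge> 1"
  shows "conf k (\<lambda>x. g (E_cube k S x))"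
  using assms(3,4)
proof (induction "\<Sum>s\<in>S. Suc k - s" arbitrary: S rule: less_induct)
  case less
  have fin: "finite S" using less.prems(1) by (rule finite_subset) simp
  show ?case
  proof (cases "S = {}")
    case True
    then have "E_cube k S x = C_cube k x" if "x \<in> cube k" for x
      using that by (auto simp: E_cube_def C_cube_def)
    then show ?thesis using less.prems(2) True by (intro conf_eqI[OF C]) auto
  next
    case False
    define i where "i = Min S"
    have i: "i \<in> S" "\<And>s. s \<in> S \<Longrightarrow> i \<le> s" using fin False by (auto simp: i_def)
    then have ik: "i \<le> k" using less.prems(1) by auto
    show ?thesis
    proof (cases "i = k")
      case True
      have "s = k" if "s \<in> S" for s
        using i(2)[OF that] less.prems(1) that True by (intro le_antisym) auto
      moreover have "k \<in> S" using i(1) True by simp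
      ultimately have "S = {k}" by blast
      then have "E_cube k S x = D_cube k x" if "x \<in> cube k" for x
        using that by (auto simp: E_cube_def D_cube_def)
      then show ?thesis by (intro conf_eqI[OF D]) auto
    next
      case False
      define T where "T = S - {i}"
      have T: "S = insert i T" "i \<notin> T" "finite T" "T \<subseteq> {0..k}"
        using i(1) fin less.prems(1) by (auto simp: T_def)
      have lt: "i < k" using ik False by simp
      have sumS: "(\<Sum>s\<in>S. Suc k - s) = (Suc k - i) + (\<Sum>s\<in>T. Suc k - s)"
        using T by simp
      have "(\<Sum>s\<in>insert (Suc i) T. Suc k - s) \<le> (Suc k - Suc i) + (\<Sum>s\<in>T. Suc k - s)"
        using T(3) by (cases "Suc i \<in> T") (auto simp: insert_absorb)
      then have "(\<Sum>s\<in>insert (Suc i) T. Suc k - s) < (\<Sum>s\<in>S. Suc k - s)"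
        using sumS lt by linarith
      then have 2: "conf k (\<lambda>x. g (E_cube k (insert (Suc i) T) x))"
        using T(4) lt by (intro less.hyps) auto
      have 1: "conf k (\<lambda>x. g (E_cube k T x))"
        using sumS T(4) lt by (intro less.hyps) auto
      have mem: "l \<in> E_cube k R x \<longleftrightarrow> l \<le> k \<and> (l \<in> R \<or> x l \<or> \<not> prev_coord x l)" for l R x
        by (auto simp: E_cube_def)
      txt \<open>The face \<open>x\<^sub>i = 1\<close> of the cube for \<open>T \<union> {i + 1}\<close> is the face \<open>x\<^sub>i = 0\<close> of the one for
        \<open>S = T \<union> {i}\<close>.\<close>
      have "conf k (\<lambda>x. if x i then g (E_cube k T (x(i := True)))
          else g (E_cube k (insert (Suc i) T) (x(i := True))))"
      proof (rule conf_glue[OF 1 2 lt])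
        fix x assume "\<not> x i"
        then have "E_cube k T x = E_cube k (insert (Suc i) T) x"
          by (intro set_eqI) (auto simp: mem)
        then show "g (E_cube k T x) = g (E_cube k (insert (Suc i) T) x)" by simp
      qed
      moreover have "E_cube k T (x(i := True)) = E_cube k S x" if "x i" for x
      proof -
        have "x(i := True) = x" using that by (intro fun_upd_idem) simp
        moreover have "E_cube k T x = E_cube k S x"
          using T(1) that by (intro set_eqI) (auto simp: mem)
        ultimately show ?thesis by simp
      qed
      moreover have "E_cube k (insert (Suc i) T) (x(i := True)) = E_cube k S x" if "\<not> x i" for x
      proof -
        have "l \<in> E_cube k (insert (Suc i) T) (x(i := True)) \<longleftrightarrow> l \<in> E_cube k S x" for l
          unfolding mem using T(1) that by (cases "l = Suc i") (auto simp: prev_coord_upd)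
        then show ?thesis by blast
      qed
      ultimately show ?thesis by (simp cong: if_cong)
    qed
  qed
qed

section \<open>Reductions of degenerable cubes\<close>

lemma conf_drp:
  assumes "conf k u" "i \<le> k"
  shows "conf (Suc k) (\<lambda>x. u (drp i x))"
proof (rule conf_reindex[OF assms(1)])
  show "drp i x \<in> cube k" if "x \<in> cube (Suc k)" for x using drp_cube that assms(2) .
  show "(\<exists>b. \<forall>x\<in>cube (Suc k). drp i x j = b) \<or>
      (\<exists>j'<Suc k. \<exists>b. \<forall>x\<in>cube (Suc k). drp i x j = (x j' = b))" if "j < k" for j
    using that
    by (intro disjI2 exI[of _ "skp i j"] conjI exI[of _ True]) (auto simp: drp_def skp_def)
qed

text \<open>As label \<open>i\<close> never occurs, \<open>skp i\<close> undoes the merger of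
  \<open>i\<close> and \<open>i + 1\<close>, so the cube is pulled back from one dimension
  lower.\<close>

lemma conf_degen_merge:
  assumes "degen k A" "i < k" "\<And>x. x \<in> cube k \<Longrightarrow> i \<notin> A x"
    and IH: "\<And>k' i A. \<lbrakk>k = Suc k'; i \<le> k'; degen k' A\<rbrakk> \<Longrightarrow> conf k' (\<lambda>x. g (skp i ` A x))"
  shows "conf k (\<lambda>x. g (A x))"
proof -
  obtain k' where k: "k = Suc k'" "i \<le> k'" using assms(2) by (cases k) auto
  have "conf k' (\<lambda>x. g (skp i ` mrg i ` A (ins i x)))"
    using degen_mrg k assms(1) by (intro IH) auto
  then have "conf k (\<lambda>x. g (skp i ` mrg i ` A (ins i (drp i x))))"
    using k unfolding k(1) by (intro conf_drp)
  moreover have "skp i ` mrg i ` A (ins i (drp i x)) = A x" if "x \<in> cube k" for x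
    using mrg_ins_drp assms(1) that k skp_mrg_image[OF assms(3)] by auto
  ultimately show ?thesis by (elim conf_eqI) simp
qed

text \<open>Both faces across axis \<open>i\<close> are related to the face with \<open>i\<close>
  and \<open>i + 1\<close> added; each link is a larger cube, and transitivity joins the two faces
  of \<open>A\<close>.\<close>

lemma conf_degen_pair:
  assumes A: "degen k A" "i < k" "depends A k i"
    and nonfull: "\<And>\<epsilon>. \<exists>x\<in>cube k. x i = \<epsilon> \<and> \<not> {i, Suc i} \<subseteq> A x"
    and bigger: "\<And>B x. \<lbrakk>degen k B; \<And>x. x \<in> cube k \<Longrightarrow> A x \<subseteq> B x; x \<in> cube k; A x \<noteq> B x\<rbrakk>
      \<Longrightarrow> conf k (\<lambda>x. g (B x))"
  shows "conf k (\<lambda>x. g (A x))"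
proof -
  define Z where "Z \<epsilon> x = A (x(i := \<epsilon>)) \<union> {i, Suc i}" for \<epsilon> x
  have Z: "Z \<epsilon> x = Z \<epsilon>' x" if "x \<in> cube k" for \<epsilon> \<epsilon>' x
  proof -
    have "l \<in> Z \<epsilon> x \<longleftrightarrow> l \<in> Z \<epsilon>' x" for l
      using degen_other[OF A(1) that A(2), of l \<epsilon>] degen_other[OF A(1) that A(2), of l \<epsilon>']
      unfolding Z_def by blast
    then show ?thesis by (rule set_eqI)
  qed
  have rel: "conf_rel k i (\<lambda>x. g (Z True x)) (\<lambda>x. g (A (x(i := \<epsilon>))))" for \<epsilon>
  proof -
    \<comment> \<open>Labels are added on the opposite face only, so one face of \<open>A\<close>
      survives; \<open>nonfull\<close> makes the enlargement proper.\<close>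
    let ?B = "\<lambda>x. A x \<union> (if x i = (\<not> \<epsilon>) then {i, Suc i} else {})"
    obtain x where x: "x \<in> cube k" "x i = (\<not> \<epsilon>)" "\<not> {i, Suc i} \<subseteq> A x"
      using nonfull[of "\<not> \<epsilon>"] by metis
    have "conf k (\<lambda>x. g (?B x))"
    proof (rule bigger)
      show "degen k ?B" using A depends_full by (intro degen_Un_face) auto
    qed (use x in auto)
    then have "conf_rel k i (\<lambda>x. g (?B (x(i := \<not> \<epsilon>)))) (\<lambda>x. g (?B (x(i := \<not> \<not> \<epsilon>))))"
      using conf_rel_faces_iff[OF A(2), of "\<lambda>x. g (?B x)" "\<not> \<epsilon>"] by blast
    then have "conf_rel k i (\<lambda>x. g (Z (\<not> \<epsilon>) x)) (\<lambda>x. g (A (x(i := \<epsilon>))))"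
      by (simp add: Z_def)
    moreover have "Z (\<not> \<epsilon>) (x(i := False)) = Z True (x(i := False))" if "x \<in> cube k" for x
      using Z that A(2) by simp
    ultimately show ?thesis
      unfolding conf_rel_def by (elim conf_eqI) simp
  qed
  have "conf_rel k i (\<lambda>x. g (A (x(i := True)))) (\<lambda>x. g (A (x(i := \<not> True))))"
    using conf_rel_trans[OF A(2) conf_rel_sym[OF A(2) rel] rel] .
  then show ?thesis using conf_rel_faces_iff[OF A(2), of "\<lambda>x. g (A x)" True] by blast
qed

text \<open>If the labels \<open>i\<close> and \<open>i + 1\<close> depend only on \<open>x\<^bsub>i-1\<^esub>\<close> and on \<open>x\<^bsub>i+1\<^esub>\<close>, respectively, then the
  faces \<open>x\<^bsub>i-1\<^esub> = \<epsilon>\<close> and \<open>x\<^bsub>i-1\<^esub> = \<not> \<epsilon>\<close> are compared through the faces with label \<open>i + 1\<close> added. On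
  the second one label \<open>i\<close> is absent, so this comparison takes place in one dimension less.\<close>

lemma conf_degen_chain:
  assumes A: "degen k A" "i < k" "\<not> depends A k i"
    and ex: "x0 \<in> cube k" "i \<notin> A x0" "x1 \<in> cube k" "Suc i \<notin> A x1" "x2 \<in> cube k" "i \<in> A x2"
    and face: "\<And>j. \<lbrakk>j < k; depends A k j\<rbrakk> \<Longrightarrow>
      \<exists>\<epsilon>. \<forall>x\<in>cube k. x j = \<epsilon> \<longrightarrow> {j, Suc j} \<subseteq> A x"
    and bigger: "\<And>B x. \<lbrakk>degen k B; \<And>x. x \<in> cube k \<Longrightarrow> A x \<subseteq> B x; x \<in> cube k; A x \<noteq> B x\<rbrakk>
      \<Longrightarrow> conf k (\<lambda>x. g (B x))"
    and IH: "\<And>k' i A. \<lbrakk>k = Suc k'; i \<le> k'; degen k' A\<rbrakk> \<Longrightarrow> conf k' (\<lambda>x. g (skp i ` A x))"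
  shows "conf k (\<lambda>x. g (A x))"
proof -
  have indep: "A (x(i := v)) = A x" if "x \<in> cube k" for x v
    using A(3) that by (auto simp: depends_def)
  have lab: "i \<in> A x \<longleftrightarrow> i \<in> A y" if "x \<in> cube k" "y \<in> cube k" "prev_coord x i = prev_coord y i" for x y
  proof -
    have "i \<in> A (x(i := y i)) \<longleftrightarrow> i \<in> A y"
      using that A(2) by (intro degen_label[OF A(1)]) (auto simp: prev_coord_upd)
    then show ?thesis using indep that(1) by simp
  qed
  \<comment> \<open>Label \<open>i\<close> sees only the preceding coordinate, which is the constant
    1 for \<open>i = 0\<close>; as the label varies, \<open>i\<close> is positive.\<close>
  obtain j where j: "i = Suc j" using lab[OF ex(1,5)] ex(2,6) by (cases i) auto
  have jk: "j < k" using A(2) j by simp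
  have ne: "x0 j \<noteq> x2 j" using lab[OF ex(1,5)] ex(2,6) j by auto
  have "i \<notin> A (x2(j := x0 j))"
    using lab[of "x2(j := x0 j)" x0] ex(1,2,5) j jk by simp
  then have dep: "depends A k j" using ex(5,6) unfolding depends_def by blast
  then obtain \<epsilon> where \<epsilon>: "\<And>x. x \<in> cube k \<Longrightarrow> x j = \<epsilon> \<Longrightarrow> {j, i} \<subseteq> A x"
    using face[OF jk] j by blast
  have x0: "x0 j = (\<not> \<epsilon>)" using \<epsilon>[OF ex(1)] ex(2) by blast
  have i_iff: "i \<in> A x \<longleftrightarrow> x j = \<epsilon>" if "x \<in> cube k" for x
    using lab[OF that ex(1)] \<epsilon>[OF that] ex(2) x0 j by auto
  \<comment> \<open>Where x_j = \<open>\<epsilon>\<close> this is the face condition; elsewhere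
    label \<open>i = j + 1\<close> is absent, so \<open>j\<close> must be present.\<close>
  have j_in: "j \<in> A x" if "x \<in> cube k" for x
    using depends_full[OF A(1) jk dep that] i_iff[OF that] \<epsilon>[OF that] j by auto
  obtain k' where k': "k = Suc k'" "i \<le> k'" "j < k'" using A(2) j by (cases k) auto
  \<comment> \<open>The chain to be built is \<open>a \<epsilon>\<close>,
    \<open>b \<epsilon>\<close>, \<open>b (\<not> \<epsilon>)\<close>,
    \<open>a (\<not> \<epsilon>)\<close>.\<close>
  define a where "a \<delta> = (\<lambda>x. g (A (x(j := \<delta>))))" for \<delta>
  define b where "b \<delta> = (\<lambda>x. g (A (x(j := \<delta>)) \<union> {Suc i}))" for \<delta>

  have "conf_rel k j (b \<epsilon>) (a \<epsilon>)"
  proof -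
    \<comment> \<open>Freezing x_j at \<open>\<epsilon>\<close> makes \<open>j\<close> and
      \<open>i\<close> present everywhere, so this cube contains \<open>A\<close>, and properly so
      at \<open>x1\<close> with x_i set to 1.\<close>
    let ?B = "\<lambda>x. A (x(j := \<epsilon>)) \<union> (if x i = True then {Suc i} else {})"
    have full: "i \<in> A (x(j := \<epsilon>))" "j \<in> A (x(j := \<epsilon>))" if "x \<in> cube k" for x
      using \<epsilon>[of "x(j := \<epsilon>)"] that jk by auto
    have "conf k (\<lambda>x. g (?B x))"
    proof (rule bigger)
      show "degen k ?B"
        using A full degen_face[OF A(1) jk] by (intro degen_Un_face) auto
      show "A x \<subseteq> ?B x" if "x \<in> cube k" for x
      proof
        fix l assume "l \<in> A x"
        then show "l \<in> ?B x"
          using degen_other[OF A(1) that jk, of l \<epsilon>] full[OF that] j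
          by (cases "l = j"; cases "l = Suc j") auto
      qed
      show "x1(i := True) \<in> cube k" using ex A(2) by simp
      have "A (x1(i := True)) = A x1" using indep ex(3) by simp
      then show "A (x1(i := True)) \<noteq> ?B (x1(i := True))" using ex(4) by auto
    qed
    \<comment> \<open>\<open>A\<close> ignores x_i, so substituting x_j for x_i only moves the
      switch for label \<open>i + 1\<close> to axis \<open>j\<close>.\<close>
    then have "conf k (\<lambda>x. g (?B (x(i := x j))))"
    proof (rule conf_reindex)
      fix h assume "h < k"
      then show "(\<exists>b. \<forall>x\<in>cube k. (x(i := x j)) h = b) \<or>
          (\<exists>j'<k. \<exists>b. \<forall>x\<in>cube k. (x(i := x j)) h = (x j' = b))"
        using jk by (intro disjI2 exI[of _ "if h = i then j else h"] conjI exI[of _ True]) auto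
    qed (use A(2) in auto)
    moreover have "?B (x(i := x j)) = (if x j then A (x(j := \<epsilon>)) \<union> {Suc i} else A (x(j := \<epsilon>)))"
      if "x \<in> cube k" for x
    proof -
      have "x(i := x j, j := \<epsilon>) = x(j := \<epsilon>, i := x j)" using j by (simp add: fun_upd_twist)
      then show ?thesis using indep[of "x(j := \<epsilon>)"] that jk by simp
    qed
    ultimately show ?thesis
      unfolding conf_rel_def a_def b_def by (elim conf_eqI) simp
  qed
  then have "conf_rel k j (a \<epsilon>) (b \<epsilon>)" by (rule conf_rel_sym[OF jk])
  moreover have "conf_rel k j (b \<epsilon>) (b (\<not> \<epsilon>))"
  proof -
    have "conf k (\<lambda>x. g (A x \<union> {Suc i}))"
    proof (rule bigger)
      show "x1 \<in> cube k" "A x1 \<noteq> A x1 \<union> {Suc i}" using ex(3,4) by auto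
      show "degen k (\<lambda>x. A x \<union> {Suc i})" using A by (intro degen_Un_const) auto
    qed auto
    then show ?thesis
      using conf_rel_faces_iff[OF jk, of "\<lambda>x. g (A x \<union> {Suc i})" \<epsilon>] by (simp only: b_def)
  qed
  moreover have "conf_rel k j (b (\<not> \<epsilon>)) (a (\<not> \<epsilon>))"
  proof -
    let ?A0 = "\<lambda>x. A (x(j := \<not> \<epsilon>))"
    \<comment> \<open>Label \<open>i\<close> is absent on this face, so merging just renames
      \<open>i + 1\<close> to \<open>i\<close>. That label may be added where x_j = 1 because
      \<open>j\<close> is always present; \<open>skp i\<close> renames it back.\<close>
    let ?B = "\<lambda>x. mrg i ` ?A0 (ins i x) \<union> (if x j = True then {i} else {})"
    have deg0: "degen (Suc k') ?A0" using degen_face[OF A(1) jk] k' by simp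
    have "degen k' ?B"
    proof (rule degen_Un_face)
      show "degen k' (\<lambda>x. mrg i ` ?A0 (ins i x))" using degen_mrg[OF deg0 k'(2)] .
      show "j \<in> mrg i ` ?A0 (ins i x) \<or> Suc j \<in> mrg i ` ?A0 (ins i x)" if "x \<in> cube k'" for x
        using j_in[of "(ins i x)(j := \<not> \<epsilon>)"] ins_cube[OF that k'(2)] jk k'(1) j
        by (simp add: mem_mrg_image)
    qed (use k' j in auto)
    then have "conf k' (\<lambda>x. g (skp i ` ?B x))" using IH k' by blast
    then have "conf k (\<lambda>x. g (skp i ` ?B (drp i x)))"
      unfolding k'(1) using k'(2) by (rule conf_drp)
    moreover have "skp i ` ?B (drp i x) = (if x j then ?A0 x \<union> {Suc i} else ?A0 x)"
      if x: "x \<in> cube k" for x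
    proof -
      have "mrg i ` ?A0 (ins i (drp i x)) = mrg i ` ?A0 x"
        using mrg_ins_drp[OF deg0 k'(2)] x k'(1) by simp
      moreover have "i \<notin> ?A0 x" using i_iff[of "x(j := \<not> \<epsilon>)"] x jk by simp
      moreover have "drp i x j = x j" using j by (simp add: drp_def skp_def)
      moreover have "skp i i = Suc i" by (simp add: skp_def)
      ultimately show ?thesis by (simp add: image_Un skp_mrg_image)
    qed
    ultimately show ?thesis
      unfolding conf_rel_def a_def b_def by (elim conf_eqI) simp
  qed
  ultimately have "conf_rel k j (a \<epsilon>) (a (\<not> \<epsilon>))"
    by (blast intro: conf_rel_trans[OF jk])
  then show ?thesis
    using conf_rel_faces_iff[OF jk, of "\<lambda>x. g (A x)" \<epsilon>] by (simp only: a_def)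
qed

text \<open>A label outside \<open>S\<close> is present exactly when one of the two coordinates it
  sees has its distinguished value \<open>\<epsilon>\<close>. As no two adjacent labels lie outside
  \<open>S\<close>, signs can be chosen coordinatewise to turn this into
  \<open>E_cube k S\<close>.\<close>

lemma conf_degen_normal:
  assumes A: "degen k A"
    and face: "\<And>j. \<lbrakk>j < k; depends A k j\<rbrakk> \<Longrightarrow>
      \<exists>\<epsilon>. \<forall>x\<in>cube k. x j = \<epsilon> \<longrightarrow> {j, Suc j} \<subseteq> A x"
    and indep: "\<And>j x y. \<lbrakk>j < k; \<not> depends A k j; x \<in> cube k; j \<notin> A x; y \<in> cube k\<rbrakk> \<Longrightarrow> Suc j \<in> A y"
    and E: "\<And>S. \<lbrakk>S \<subseteq> {0..k}; S \<noteq> {} \<or> k \<ge> 1\<rbrakk> \<Longrightarrow> conf k (\<lambda>x. g (E_cube k S x))"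
  shows "conf k (\<lambda>x. g (A x))"
proof -
  have "\<forall>j. \<exists>\<epsilon>. j < k \<and> depends A k j \<longrightarrow> (\<forall>x\<in>cube k. x j = \<epsilon> \<longrightarrow> {j, Suc j} \<subseteq> A x)"
    using face by simp
  from choice[OF this] obtain \<epsilon> where
    "\<forall>j. j < k \<and> depends A k j \<longrightarrow> (\<forall>x\<in>cube k. x j = \<epsilon> j \<longrightarrow> {j, Suc j} \<subseteq> A x)" ..
  then have \<epsilon>: "{j, Suc j} \<subseteq> A x" if "j < k" "depends A k j" "x \<in> cube k" "x j = \<epsilon> j" for j x
    using that by simp
  define S where "S = {l \<in> {0..k}. \<forall>x\<in>cube k. l \<in> A x}"
  \<comment> \<open>Coordinate \<open>j\<close> takes the value that forces both labels
    \<open>j\<close> and \<open>j + 1\<close>.\<close>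
  define u where "u x j \<longleftrightarrow> j < k \<and> depends A k j \<and> x j = \<epsilon> j" for x j
  have uD: "j \<in> A x" "Suc j \<in> A x" if "u x j" "x \<in> cube k" for x j
    using \<epsilon>[of j x] that by (auto simp: u_def)
  \<comment> \<open>If \<open>u\<close> fails at both points, then \<open>A\<close> ignores
    coordinate \<open>j\<close> or the two points agree there.\<close>
  have shift: "A (x(j := w j)) = A x" if "x \<in> cube k" "w \<in> cube k" "\<not> u x j" "\<not> u w j" for x w j
  proof (cases "j < k \<and> \<not> depends A k j")
    case True
    then show ?thesis using that(1) by (auto simp: depends_def)
  next
    case False
    have "x j = w j"
    proof (cases "j < k")
      case True
      then show ?thesis using False that(3,4) by (auto simp: u_def)
    qed (use that(1,2) in \<open>auto simp: cube_def\<close>)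
    then show ?thesis by (simp add: fun_upd_idem)
  qed
  have upd: "x(j := w j) \<in> cube k" if "x \<in> cube k" "w \<in> cube k" for x w :: "nat \<Rightarrow> bool" and j
    using that by (auto simp: cube_def)
  have lab: "l \<in> A x \<longleftrightarrow> u x l \<or> (\<exists>j. l = Suc j \<and> u x j)"
    if x: "x \<in> cube k" and l: "l \<notin> S" "l \<le> k" for x l
  proof
    show "l \<in> A x" if "u x l \<or> (\<exists>j. l = Suc j \<and> u x j)" using that uD x by auto
  next
    assume in_A: "l \<in> A x"
    \<comment> \<open>At \<open>w\<close>, \<open>u\<close> fails for both coordinates seen by
      \<open>l\<close>. If it failed at \<open>x\<close> too, these could be copied from
      \<open>w\<close> without changing \<open>A x\<close>, and \<open>l\<close> would be absent
      from \<open>A x\<close>.\<close>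
    obtain w where w: "w \<in> cube k" "l \<notin> A w" using l by (auto simp: S_def)
    show "u x l \<or> (\<exists>j. l = Suc j \<and> u x j)"
    proof (rule ccontr)
      assume neg: "\<not> (u x l \<or> (\<exists>j. l = Suc j \<and> u x j))"
      have nw: "\<not> u w l" "\<And>j. l = Suc j \<Longrightarrow> \<not> u w j" using uD w by auto
      have x': "x(l := w l) \<in> cube k" "l \<in> A (x(l := w l))"
        using upd x w(1) shift[of x w l] neg nw(1) in_A by auto
      show False
      proof (cases l)
        case 0
        then have "l \<in> A (x(l := w l)) \<longleftrightarrow> l \<in> A w"
          using x'(1) w(1) by (intro degen_label[OF A]) auto
        then show False using x'(2) w(2) by simp
      next
        case (Suc j)
        have "\<not> u (x(l := w l)) j" using neg Suc by (auto simp: u_def)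
        then have "l \<in> A (x(l := w l, j := w j))"
          using shift[OF x'(1) w(1)] nw(2) Suc x'(2) by auto
        moreover have "l \<in> A (x(l := w l, j := w j)) \<longleftrightarrow> l \<in> A w"
          using upd[OF x'(1) w(1)] w(1) Suc by (intro degen_label[OF A]) auto
        ultimately show False using w(2) by simp
      qed
    qed
  qed
  have adj: "l \<in> S \<or> Suc l \<in> S" if lk: "l < k" for l
  proof (rule ccontr)
    assume "\<not> (l \<in> S \<or> Suc l \<in> S)"
    then obtain p q where p: "p \<in> cube k" "l \<notin> A p" and q: "q \<in> cube k" "Suc l \<notin> A q"
      using lk by (auto simp: S_def)
    have dep: "depends A k l" using indep[OF lk _ p q(1)] q(2) by blast
    have pq: "p l = q l" using \<epsilon>[OF lk dep p(1)] \<epsilon>[OF lk dep q(1)] p(2) q(2) by auto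
    \<comment> \<open>\<open>p\<close> and \<open>q\<close> agree in coordinate \<open>l\<close>, so
      this splice lacks both labels.\<close>
    define y where "y = (\<lambda>j. if j \<le> l then p j else q j)"
    have y: "y \<in> cube k" using p(1) q(1) by (auto simp: y_def cube_def)
    have "l \<in> A y \<longleftrightarrow> l \<in> A p"
      by (rule degen_label[OF A y p(1)]) (auto simp: y_def prev_coord_def split: nat.splits)
    moreover have "Suc l \<in> A y \<longleftrightarrow> Suc l \<in> A q"
      by (rule degen_label[OF A y q(1)]) (auto simp: y_def pq)
    ultimately show False using depends_full[OF A lk dep y] p(2) q(2) by blast
  qed
  \<comment> \<open>The sign is reversed on \<open>S\<close> because a label outside
    \<open>S\<close> reads its predecessor, which lies in \<open>S\<close> by \<open>adj\<close>,
    negated.\<close>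
  define \<phi> where "\<phi> x = (\<lambda>j. j < k \<and> (if j \<in> S then \<not> u x j else u x j))" for x
  have "E_cube k S (\<phi> x) = A x" if x: "x \<in> cube k" for x
  proof (rule set_eqI)
    fix l
    show "l \<in> E_cube k S (\<phi> x) \<longleftrightarrow> l \<in> A x"
    proof (cases "l \<le> k \<and> l \<notin> S")
      case True
      have "\<phi> x l \<longleftrightarrow> u x l" using True by (auto simp: \<phi>_def u_def)
      moreover have "\<not> prev_coord (\<phi> x) l \<longleftrightarrow> (\<exists>j. l = Suc j \<and> u x j)"
      proof (cases l)
        case (Suc j)
        then have "j \<in> S" "j < k" using adj[of j] True by auto
        then show ?thesis using Suc by (auto simp: \<phi>_def)
      qed simp
      ultimately show ?thesis using lab[OF x] True by (auto simp: E_cube_def)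
    next
      case False
      then show ?thesis using degen_le[OF A x] x by (auto simp: E_cube_def S_def)
    qed
  qed
  moreover have "conf k (\<lambda>x. g (E_cube k S (\<phi> x)))"
  proof (rule conf_reindex)
    have "0 \<in> S" if "k = 0"
      using degen_Sub[OF A] that by (auto simp: S_def Sub_def)
    then have "S \<noteq> {} \<or> k \<ge> 1" by (cases k) auto
    then show "conf k (\<lambda>x. g (E_cube k S x))" by (intro E) (auto simp: S_def)
    show "\<phi> x \<in> cube k" for x by (auto simp: \<phi>_def cube_def)
    show "(\<exists>b. \<forall>x\<in>cube k. \<phi> x j = b) \<or> (\<exists>j'<k. \<exists>b. \<forall>x\<in>cube k. \<phi> x j = (x j' = b))"
      if "j < k" for j
    proof (cases "depends A k j")
      case True
      then show ?thesis using that
        by (intro disjI2 exI[of _ j] conjI exI[of _ "\<epsilon> j = (j \<notin> S)"]) (auto simp: \<phi>_def u_def)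
    next
      case False
      then show ?thesis by (intro disjI1 exI[of _ "j < k \<and> j \<in> S"]) (auto simp: \<phi>_def u_def)
    qed
  qed
  ultimately show ?thesis by (elim conf_eqI) simp
qed

text \<open>Induction on the number of absent labels over all points. Each reduction enlarges the
  cube or lowers its dimension, and a cube admitting none is in normal form.\<close>

lemma conf_degen:
  assumes E: "\<And>S. \<lbrakk>S \<subseteq> {0..k}; S \<noteq> {} \<or> k \<ge> 1\<rbrakk> \<Longrightarrow> conf k (\<lambda>x. g (E_cube k S x))"
    and IH: "\<And>k' i A. \<lbrakk>k = Suc k'; i \<le> k'; degen k' A\<rbrakk> \<Longrightarrow> conf k' (\<lambda>x. g (skp i ` A x))"
    and "degen k A"
  shows "conf k (\<lambda>x. g (A x))"
  using assms(3)
proof (induction "card {(x, l). x \<in> cube k \<and> l \<le> k \<and> l \<notin> A x}" arbitrary: A rule: less_induct)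
  case less
  have bigger: "conf k (\<lambda>x. g (B x))"
    if B: "degen k B" "\<And>x. x \<in> cube k \<Longrightarrow> A x \<subseteq> B x" "x \<in> cube k" "A x \<noteq> B x" for B x
  proof (rule less.hyps)
    let ?zeros = "\<lambda>A. {(x, l). x \<in> cube k \<and> l \<le> k \<and> l \<notin> A x}"
    obtain l where l: "l \<in> B x" "l \<notin> A x" using B(2-4) by blast
    then have "(x, l) \<in> ?zeros A" "(x, l) \<notin> ?zeros B" using B(3) degen_le[OF B(1,3)] by auto
    moreover have "?zeros B \<subseteq> ?zeros A" using B(2) by auto
    ultimately have "?zeros B \<subset> ?zeros A" by blast
    moreover have "finite (?zeros A)"
      by (rule finite_subset[of _ "cube k \<times> {..k}"]) (auto simp: finite_cube)
    ultimately show "card (?zeros B) < card (?zeros A)" by (intro psubset_card_mono)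
  qed (rule B(1))
  show ?case
  proof (cases "\<exists>i<k. \<forall>x\<in>cube k. i \<notin> A x")
    case True
    then obtain i where i: "i < k" "\<forall>x\<in>cube k. i \<notin> A x" by blast
    show ?thesis
    proof (rule conf_degen_merge[OF less.prems i(1)])
      show "i \<notin> A x" if "x \<in> cube k" for x using i(2) that ..
    qed (rule IH)
  next
    case nonzero: False
    show ?thesis
    proof (cases "\<forall>j<k. depends A k j \<longrightarrow> (\<exists>\<epsilon>. \<forall>x\<in>cube k. x j = \<epsilon> \<longrightarrow> {j, Suc j} \<subseteq> A x)")
      case False
      then obtain i where i: "i < k" "depends A k i"
        and "\<not> (\<exists>\<epsilon>. \<forall>x\<in>cube k. x i = \<epsilon> \<longrightarrow> {i, Suc i} \<subseteq> A x)"
        unfolding not_all not_imp by (elim exE conjE)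
      then have "\<not> (\<forall>x\<in>cube k. x i = \<epsilon> \<longrightarrow> {i, Suc i} \<subseteq> A x)" for \<epsilon>
        by (elim contrapos_nn exI)
      then have "\<exists>x\<in>cube k. x i = \<epsilon> \<and> \<not> {i, Suc i} \<subseteq> A x" for \<epsilon>
        by (simp only: not_imp ball_simps)
      then show ?thesis by (rule conf_degen_pair[where g = g, OF less.prems i _ bigger])
    next
      case True
      then have face: "\<exists>\<epsilon>. \<forall>x\<in>cube k. x j = \<epsilon> \<longrightarrow> {j, Suc j} \<subseteq> A x" if "j < k" "depends A k j" for j
        using that by simp
      show ?thesis
      proof (cases "\<exists>i<k. \<not> depends A k i \<and> (\<exists>x\<in>cube k. i \<notin> A x) \<and> (\<exists>x\<in>cube k. Suc i \<notin> A x)")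
        case True
        then obtain i x0 x1 where i: "i < k" "\<not> depends A k i"
          "x0 \<in> cube k" "i \<notin> A x0" "x1 \<in> cube k" "Suc i \<notin> A x1" by blast
        then obtain x2 where x2: "x2 \<in> cube k" "i \<in> A x2" using nonzero by blast
        show ?thesis by (rule conf_degen_chain[where g = g, OF less.prems i x2 face bigger IH])
      next
        case False
        then have indep: "Suc j \<in> A y"
          if "j < k" "\<not> depends A k j" "x \<in> cube k" "j \<notin> A x" "y \<in> cube k" for j x y
          using that by blast
        show ?thesis by (rule conf_degen_normal[OF less.prems face indep E])
      qed
    qed
  qed
qed

section \<open>From injections to all monotone maps\<close>

lemma CD_condD:
  assumes "CD_cond X n f" "mono_on {0..m} \<tau>" "\<tau> ` {0..m} \<subseteq> {0..n}" "inj_on \<tau> {0..m}"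
  shows "m \<ge> 1 \<Longrightarrow> conf m (\<lambda>x. f (\<tau> ` C_cube m x))" "conf m (\<lambda>x. f (\<tau> ` D_cube m x))"
proof -
  let ?\<iota> = "restrict \<tau> {0..m}"
  have "?\<iota> \<in> Delta_hom m n"
    using assms(2,3) by (auto simp: Delta_hom_def mono_on_def)
  moreover have "inj_on ?\<iota> {0..m}" using assms(4) by (simp add: inj_on_restrict_eq)
  ultimately have CD: "m \<ge> 1 \<Longrightarrow> conf m (\<lambda>x. f (?\<iota> ` C_cube m x))" "conf m (\<lambda>x. f (?\<iota> ` D_cube m x))"
    using assms(1) unfolding CD_cond_def conf_def by blast+
  have "?\<iota> ` C_cube m x = \<tau> ` C_cube m x" "?\<iota> ` D_cube m x = \<tau> ` D_cube m x"
    if "x \<in> cube m" for x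
    using that by (auto simp: C_cube_def D_cube_def intro!: image_cong)
  then show "m \<ge> 1 \<Longrightarrow> conf m (\<lambda>x. f (\<tau> ` C_cube m x))" "conf m (\<lambda>x. f (\<tau> ` D_cube m x))"
    by (auto intro: conf_eqI[OF CD(1)] conf_eqI[OF CD(2)])
qed

text \<open>Induction on the dimension for all \<open>\<tau>\<close> at once, since lowering the
  dimension composes \<open>\<tau>\<close> with a coface. If \<open>\<tau>\<close> identifies
  \<open>i\<close> and \<open>i + 1\<close>, it factors through \<open>mrg i\<close>, and the cube
  is pulled back along \<open>drp i\<close>.\<close>

lemma conf_image_degen:
  assumes "CD_cond X n f" "degen k A" "mono_on {0..k} \<tau>" "\<tau> ` {0..k} \<subseteq> {0..n}"
  shows "conf k (\<lambda>x. f (\<tau> ` A x))"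
  using assms(2-)
proof (induction k arbitrary: A \<tau> rule: less_induct)
  case (less k)
  have IH: "conf k' (\<lambda>x. f (\<tau> ` skp i ` B x))" if "k = Suc k'" "i \<le> k'" "degen k' B" for k' i B
  proof -
    have skp: "skp i j \<in> {0..k}" if "j \<in> {0..k'}" for j
      using that \<open>k = Suc k'\<close> by (auto simp: skp_def)
    have "conf k' (\<lambda>x. f ((\<tau> \<circ> skp i) ` B x))"
    proof (rule less.IH)
      show "mono_on {0..k'} (\<tau> \<circ> skp i)"
      proof (rule mono_onI)
        fix a b assume "a \<in> {0..k'}" "b \<in> {0..k'}" "a \<le> b"
        moreover from this have "skp i a \<le> skp i b" by (auto simp: skp_def)
        ultimately show "(\<tau> \<circ> skp i) a \<le> (\<tau> \<circ> skp i) b"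
          using skp mono_onD[OF less.prems(2)] by simp
      qed
      show "(\<tau> \<circ> skp i) ` {0..k'} \<subseteq> {0..n}" using less.prems(3) skp by fastforce
    qed (use that in auto)
    then show ?thesis by (simp only: image_comp)
  qed
  show ?case
  proof (cases "inj_on \<tau> {0..k}")
    case True
    show ?thesis
    proof (rule conf_degen[where g = "\<lambda>S. f (\<tau> ` S)", OF _ IH less.prems(1)])
      show "conf k (\<lambda>x. f (\<tau> ` E_cube k S x))" if "S \<subseteq> {0..k}" "S \<noteq> {} \<or> k \<ge> 1" for S
        using conf_E_cube[where g = "\<lambda>S. f (\<tau> ` S)", OF CD_condD[OF assms(1) less.prems(2,3) True] that] .
    qed
  next
    case False
    have "\<exists>i<k. \<tau> i = \<tau> (Suc i)"
    proof (rule ccontr)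
      assume neq: "\<not> (\<exists>i<k. \<tau> i = \<tau> (Suc i))"
      have "\<tau> a < \<tau> b" if "a < b" "b \<le> k" for a b
      proof -
        have "\<tau> a \<le> \<tau> (Suc a)" "\<tau> (Suc a) \<le> \<tau> b"
          using that by (auto intro!: mono_onD[OF less.prems(2)])
        moreover have "\<tau> a \<noteq> \<tau> (Suc a)" using neq that by auto
        ultimately show ?thesis by simp
      qed
      then have "inj_on \<tau> {0..k}"
        by (intro linorder_inj_onI) (auto simp: less_imp_neq)
      then show False using False by simp
    qed
    then obtain i where i: "i < k" "\<tau> i = \<tau> (Suc i)" by blast
    then obtain k' where k: "k = Suc k'" "i \<le> k'" by (cases k) auto
    have deg: "degen (Suc k') A" using less.prems(1) k by simp
    have "conf k' (\<lambda>x. f (\<tau> ` skp i ` mrg i ` A (ins i x)))"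
      by (rule IH[OF k degen_mrg[OF deg k(2)]])
    then have "conf k (\<lambda>x. f (\<tau> ` skp i ` mrg i ` A (ins i (drp i x))))"
      unfolding k(1) using k(2) by (rule conf_drp)
    moreover have "\<tau> ` skp i ` mrg i ` A (ins i (drp i x)) = \<tau> ` A x" if "x \<in> cube k" for x
    proof -
      have "\<tau> (skp i (mrg i j)) = \<tau> j" for j
        using i(2) by (cases "j = i") (auto simp: skp_def mrg_def)
      then have "\<tau> ` skp i ` mrg i ` A x = \<tau> ` A x" by (simp only: image_image)
      then show ?thesis using mrg_ins_drp[OF deg k(2)] that k(1) by simp
    qed
    ultimately show ?thesis by (elim conf_eqI) simp
  qed
qed

lemma CD_cond_imp_K_cond:
  assumes "CD_cond X n f"
  shows "K_cond X n f"
  unfolding K_cond_def conf_def[symmetric]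
proof (intro allI ballI)
  fix m c assume "c \<in> cells (K_cubeset n) m"
  then obtain k \<phi> A \<sigma> where c: "c = (\<lambda>x\<in>cube m. \<sigma> ` A (\<phi> x))"
    and *: "\<phi> \<in> box_hom m k" "degenerable k A" "\<sigma> \<in> Delta_hom k n"
    by (auto simp: K_cubeset_def)
  have "conf k (\<lambda>x. f (\<sigma> ` A x))"
    using * by (intro conf_image_degen[OF assms]) (auto simp: degenerable_iff Delta_hom_def)
  from conf_box_hom[OF this *(1)] show "conf m (\<lambda>x. f (c x))"
    by (elim conf_eqI) (simp add: c)
qed

end

section \<open>Morphisms out of the kernel\<close>

text \<open>Of the labels \<open>i\<close> and \<open>i + 1\<close>, the first is present where x_i
  = 1 and the second where x_i = 0. For \<open>i = 0\<close> this also gives nonemptiness.\<close>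

lemma degenerable_C_cube:
  assumes "m \<ge> 1"
  shows "degenerable m (C_cube m)"
proof -
  have mem: "l \<in> C_cube m x \<longleftrightarrow> l \<le> m \<and> (x l \<or> \<not> prev_coord x l)" if "x \<in> cube m" for x l
    using that by (auto simp: C_cube_def)
  have "degen m (C_cube m)"
  proof (rule degenI)
    fix x assume "x \<in> cube m"
    then have "0 \<in> C_cube m x \<or> 1 \<in> C_cube m x" using assms by (auto simp: mem)
    then show "C_cube m x \<noteq> {}" by auto
  qed (auto simp: mem prev_coord_upd)
  then show ?thesis by (auto simp: degenerable_iff C_cube_def)
qed

lemma K_cellsI:
  "\<phi> \<in> box_hom m k \<Longrightarrow> degenerable k A \<Longrightarrow> \<sigma> \<in> Delta_hom k n \<Longrightarrow>
    (\<lambda>x\<in>cube m. \<sigma> ` A (\<phi> x)) \<in> cells (K_cubeset n) m"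
  unfolding K_cubeset_def by auto

lemma K_cond_imp_C_cond:
  assumes "K_cond X n f"
  shows "C_cond X n f"
  unfolding C_cond_def
proof (intro allI impI ballI)
  fix m :: nat and \<sigma> assume m: "m \<ge> 1" and \<sigma>: "\<sigma> \<in> Delta_hom m n"
  let ?c = "\<lambda>x\<in>cube m. \<sigma> ` C_cube m ((\<lambda>x\<in>cube m. x) x)"
  have "?c \<in> cells (K_cubeset n) m"
    using id_box_hom degenerable_C_cube[OF m] \<sigma> by (rule K_cellsI)
  then have "(\<lambda>x\<in>cube m. f (?c x)) \<in> configs X m" using assms unfolding K_cond_def by blast
  also have "(\<lambda>x\<in>cube m. f (?c x)) = (\<lambda>x\<in>cube m. f (\<sigma> ` C_cube m x))" by auto
  finally show "(\<lambda>x\<in>cube m. f (\<sigma> ` C_cube m x)) \<in> configs X m" .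
qed

context cubeset begin

text \<open>On the face x_m = 0 of \<open>C_cube (Suc m)\<close> the label \<open>m + 1\<close> is
  always present; merging it with \<open>m\<close> yields \<open>D_cube m\<close>.\<close>

lemma C_cond_imp_CD_cond:
  assumes "C_cond X n f"
  shows "CD_cond X n f"
  unfolding CD_cond_def conf_def[symmetric]
proof (intro allI ballI impI conjI)
  fix m \<iota> assume \<iota>: "\<iota> \<in> Delta_hom m n"
  show "conf m (\<lambda>x. f (\<iota> ` C_cube m x))" if "m \<ge> 1"
    using assms \<iota> that by (auto simp: C_cond_def conf_def)
  let ?\<sigma> = "\<lambda>j\<in>{0..Suc m}. \<iota> (mrg m j)"
  have mrg: "mrg m j \<in> {0..m}" if "j \<in> {0..Suc m}" for j using that by (auto simp: mrg_def)
  have "?\<sigma> \<in> Delta_hom (Suc m) n"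
  proof -
    have "mono_on {0..Suc m} ?\<sigma>"
    proof (rule mono_onI)
      fix a b assume ab: "a \<in> {0..Suc m}" "b \<in> {0..Suc m}" "a \<le> b"
      then have "mrg m a \<le> mrg m b" by (auto simp: mrg_def)
      then show "?\<sigma> a \<le> ?\<sigma> b"
        using \<iota> mrg ab(1,2) by (simp add: Delta_hom_def mono_on_def)
    qed
    then show ?thesis using \<iota> mrg unfolding Delta_hom_def by (auto simp: PiE_iff)
  qed
  moreover have "1 \<le> Suc m" by simp
  ultimately have "conf (Suc m) (\<lambda>x. f (?\<sigma> ` C_cube (Suc m) x))"
    using assms unfolding C_cond_def conf_def by blast
  then have "conf m (\<lambda>x. f (?\<sigma> ` C_cube (Suc m) x))"
  proof (rule conf_reindex)
    \<comment> \<open>By the padding, \<open>cube m\<close> is the face x_m = 0 of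
      \<open>cube (Suc m)\<close>.\<close>
    show "x \<in> cube (Suc m)" if "x \<in> cube m" for x using that by (auto simp: cube_def)
    show "(\<exists>b. \<forall>x\<in>cube m. x i = b) \<or> (\<exists>j<m. \<exists>b. \<forall>x\<in>cube m. x i = (x j = b))" for i
    proof (cases "i < m")
      case True
      then show ?thesis by (intro disjI2 exI[of _ i] conjI exI[of _ True]) auto
    next
      case False
      then show ?thesis by (intro disjI1 exI[of _ False]) (auto simp: cube_def)
    qed
  qed
  moreover have "?\<sigma> ` C_cube (Suc m) x = \<iota> ` D_cube m x" if x: "x \<in> cube m" for x
  proof -
    have x': "x \<in> cube (Suc m)" "\<not> x m" using x by (auto simp: cube_def)
    have "?\<sigma> ` C_cube (Suc m) x = (\<lambda>j. \<iota> (mrg m j)) ` C_cube (Suc m) x"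
      using x' by (intro image_cong) (auto simp: C_cube_def)
    also have "\<dots> = \<iota> ` mrg m ` C_cube (Suc m) x" by (simp add: image_image)
    also have "mrg m ` C_cube (Suc m) x = D_cube m x"
      using x x' by (intro set_eqI) (auto simp: mem_mrg_image C_cube_def D_cube_def)
    finally show ?thesis .
  qed
  ultimately show "conf m (\<lambda>x. f (\<iota> ` D_cube m x))" by (elim conf_eqI) (simp only:)
qed

end

section \<open>Cells of the kernel\<close>

lemma K_cells_Sub:
  assumes "c \<in> cells (K_cubeset n) m" "x \<in> cube m"
  shows "c x \<in> Sub n"
proof -
  obtain k \<phi> A \<sigma> where c: "c = (\<lambda>x\<in>cube m. \<sigma> ` A (\<phi> x))"
    and *: "\<phi> \<in> box_hom m k" "degenerable k A" "\<sigma> \<in> Delta_hom k n"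
    using assms(1) by (auto simp: K_cubeset_def)
  have "A (\<phi> x) \<in> Sub k"
    using * degen_Sub box_hom_cube assms(2) by (auto simp: degenerable_iff)
  then show ?thesis using *(3) assms(2) c by (auto simp: Sub_def Delta_hom_def)
qed

lemma K_cells_compose:
  assumes "c \<in> cells (K_cubeset n) m" "\<phi> \<in> box_hom l m"
  shows "compose (cube l) c \<phi> \<in> cells (K_cubeset n) l"
proof -
  obtain k \<psi> A \<sigma> where c: "c = (\<lambda>x\<in>cube m. \<sigma> ` A (\<psi> x))"
    and *: "\<psi> \<in> box_hom m k" "degenerable k A" "\<sigma> \<in> Delta_hom k n"
    using assms(1) by (auto simp: K_cubeset_def)
  have "compose (cube l) c \<phi> = (\<lambda>x\<in>cube l. \<sigma> ` A (compose (cube l) \<psi> \<phi> x))"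
    unfolding compose_def using box_hom_cube[OF assms(2)] by (intro restrict_ext) (simp add: c)
  then show ?thesis using K_cellsI[OF compose_box_hom[OF assms(2) *(1)] *(2,3)] by simp
qed

lemma K_cells_const:
  assumes "S \<in> Sub n"
  shows "(\<lambda>_\<in>cube m. S) \<in> cells (K_cubeset n) m"
proof -
  let ?A = "\<lambda>_\<in>cube n. S" and ?\<sigma> = "\<lambda>j\<in>{0..n}. j"
  define z :: "nat \<Rightarrow> bool" where "z = (\<lambda>_. False)"
  have z: "z \<in> cube n" by (auto simp: z_def cube_def)
  have A: "degenerable n ?A" using assms by (auto simp: degenerable_iff degen_def)
  have \<sigma>: "?\<sigma> \<in> Delta_hom n n" by (auto simp: Delta_hom_def mono_on_def)
  have "?\<sigma> ` S = S" using assms by (force simp: Sub_def)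
  then have "(\<lambda>_\<in>cube m. S) = (\<lambda>x\<in>cube m. ?\<sigma> ` ?A ((\<lambda>_\<in>cube m. z) x))"
    using z by (intro restrict_ext) (simp only: restrict_apply if_True)
  then show ?thesis using K_cellsI[OF const_box_hom[OF z] A \<sigma>] by (simp only:)
qed

lemma act_K_cubeset: "act (K_cubeset n) l m \<phi> c = compose (cube l) c \<phi>"
  by (simp add: K_cubeset_def)

lemma K_star_iff: "\<eta> \<in> K_star X n \<longleftrightarrow> (\<forall>m. \<eta> m \<in> cells (K_cubeset n) m \<rightarrow>\<^sub>E cells X m) \<and>
  (\<forall>l m. \<forall>\<phi>\<in>box_hom l m. \<forall>c\<in>cells (K_cubeset n) m.
    \<eta> l (compose (cube l) c \<phi>) = act X l m \<phi> (\<eta> m c))"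
  unfolding K_star_def cubeset_hom_def act_K_cubeset by blast

lemma on_zero_cubes_apply: "S \<in> Sub n \<Longrightarrow> on_zero_cubes n \<eta> S = \<eta> 0 (\<lambda>_\<in>cube 0. S)"
  unfolding on_zero_cubes_def by (rule restrict_apply')

section \<open>Morphisms recovered from their maps on 0-cubes\<close>

context concrete_cubeset begin

text \<open>Naturality along inclusions of vertices. By concreteness a morphism is then determined
  by its map on 0-cubes.\<close>

lemma vertices_K_star:
  assumes "\<eta> \<in> K_star X n" "c \<in> cells (K_cubeset n) m"
  shows "vertices X m (\<eta> m c) = (\<lambda>x\<in>cube m. on_zero_cubes n \<eta> (c x))"
proof -
  have "act X 0 m (\<lambda>_\<in>cube 0. x) (\<eta> m c) = on_zero_cubes n \<eta> (c x)" if "x \<in> cube m" for x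
  proof -
    have "act X 0 m (\<lambda>_\<in>cube 0. x) (\<eta> m c) = \<eta> 0 (compose (cube 0) c (\<lambda>_\<in>cube 0. x))"
      using assms const_box_hom[OF that] unfolding K_star_iff by metis
    also have "compose (cube 0) c (\<lambda>_\<in>cube 0. x) = (\<lambda>_\<in>cube 0. c x)"
      unfolding compose_def by (intro restrict_ext) simp
    finally show ?thesis by (simp only: on_zero_cubes_apply[OF K_cells_Sub[OF assms(2) that]])
  qed
  then show ?thesis by (auto simp: vertices_def)
qed

lemma K_star_cells:
  "\<eta> \<in> K_star X n \<Longrightarrow> c \<in> cells (K_cubeset n) m \<Longrightarrow> \<eta> m c \<in> cells X m"
  by (auto simp: K_star_iff)

lemma on_zero_cubes_K_cond:
  assumes "\<eta> \<in> K_star X n"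
  shows "on_zero_cubes n \<eta> \<in> Sub n \<rightarrow>\<^sub>E cells X 0" "K_cond X n (on_zero_cubes n \<eta>)"
proof -
  show "on_zero_cubes n \<eta> \<in> Sub n \<rightarrow>\<^sub>E cells X 0"
    using K_star_cells[OF assms K_cells_const] by (auto simp: on_zero_cubes_def)
  show "K_cond X n (on_zero_cubes n \<eta>)"
    unfolding K_cond_def configs_def
    using vertices_K_star[OF assms] K_star_cells[OF assms] by (metis image_eqI)
qed

lemma inj_on_zero_cubes: "inj_on (on_zero_cubes n) (K_star X n)"
proof (rule inj_onI)
  fix \<eta> \<theta> assume *: "\<eta> \<in> K_star X n" "\<theta> \<in> K_star X n" "on_zero_cubes n \<eta> = on_zero_cubes n \<theta>"
  have "\<eta> m c = \<theta> m c" for m c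
  proof (cases "c \<in> cells (K_cubeset n) m")
    case True
    then show ?thesis
      using inj_onD[OF inj_vertices] vertices_K_star[OF *(1) True] vertices_K_star[OF *(2) True]
        K_star_cells *(1,2) unfolding *(3) by metis
  next
    case False
    then show ?thesis using *(1,2) PiE_arb unfolding K_star_iff by metis
  qed
  then show "\<eta> = \<theta>" by blast
qed

text \<open>The value at \<open>c\<close> is the unique cell with vertices \<open>f (c x)\<close>.
  Naturality is tested on vertices, where both sides are \<open>f (c (\<phi> x))\<close>.\<close>

lemma ex_K_star:
  assumes f: "f \<in> Sub n \<rightarrow>\<^sub>E cells X 0" "K_cond X n f"
  shows "\<exists>\<eta>\<in>K_star X n. on_zero_cubes n \<eta> = f"
proof -
  define \<eta> where "\<eta> m = (\<lambda>c\<in>cells (K_cubeset n) m.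
    inv_into (cells X m) (vertices X m) (\<lambda>x\<in>cube m. f (c x)))" for m
  have mem: "\<eta> m c \<in> cells X m" and vert: "vertices X m (\<eta> m c) = (\<lambda>x\<in>cube m. f (c x))"
    if "c \<in> cells (K_cubeset n) m" for m c
  proof -
    have "(\<lambda>x\<in>cube m. f (c x)) \<in> vertices X m ` cells X m"
      using f(2) that by (simp add: K_cond_def configs_def)
    then show "\<eta> m c \<in> cells X m" "vertices X m (\<eta> m c) = (\<lambda>x\<in>cube m. f (c x))"
      using that by (simp_all add: \<eta>_def inv_into_into f_inv_into_f)
  qed
  have "\<eta> l (compose (cube l) c \<phi>) = act X l m \<phi> (\<eta> m c)"
    if "\<phi> \<in> box_hom l m" "c \<in> cells (K_cubeset n) m" for l m \<phi> c
  proof (rule inj_onD[OF inj_vertices])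
    have "vertices X l (act X l m \<phi> (\<eta> m c)) = (\<lambda>x\<in>cube l. f (c (\<phi> x)))"
      using vertices_act[OF that(1) mem[OF that(2)]] vert[OF that(2)] box_hom_cube[OF that(1)] by auto
    moreover have "vertices X l (\<eta> l (compose (cube l) c \<phi>)) = (\<lambda>x\<in>cube l. f (c (\<phi> x)))"
      using vert[OF K_cells_compose[OF that(2,1)]] by (auto simp: compose_def)
    ultimately show "vertices X l (\<eta> l (compose (cube l) c \<phi>)) = vertices X l (act X l m \<phi> (\<eta> m c))"
      by simp
  qed (use mem K_cells_compose act_closed that in auto)
  then have "\<eta> \<in> K_star X n"
    unfolding K_star_iff using mem by (auto simp: \<eta>_def)
  moreover have "on_zero_cubes n \<eta> = f"
  proof
    fix S
    show "on_zero_cubes n \<eta> S = f S"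
    proof (cases "S \<in> Sub n")
      case True
      let ?c = "\<lambda>_\<in>cube 0. S"
      have c: "?c \<in> cells (K_cubeset n) 0" using K_cells_const[OF True] .
      have z: "(\<lambda>_. False) \<in> cube 0" by (simp add: cube_def)
      have "(\<lambda>_\<in>cube 0. \<eta> 0 ?c) = (\<lambda>x\<in>cube 0. f (?c x))"
        using vertices_0[OF mem[OF c]] vert[OF c] by simp
      from fun_cong[OF this, of "\<lambda>_. False"] have "\<eta> 0 ?c = f S" using z by simp
      then show ?thesis by (simp only: on_zero_cubes_apply[OF True])
    next
      case False
      then show ?thesis using f(1) by (auto simp: on_zero_cubes_def)
    qed
  qed
  ultimately show ?thesis by blast
qed

lemma bij_betw_on_zero_cubes:
  "bij_betw (on_zero_cubes n) (K_star X n) {f \<in> Sub n \<rightarrow>\<^sub>E cells X 0. K_cond X n f}"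
  unfolding bij_betw_def using inj_on_zero_cubes on_zero_cubes_K_cond ex_K_star by blast

end

theorem mainTheorem4:
  fixes X :: "'a presheaf_data" and n :: nat
  assumes "concrete_cubeset X" and "gluing_property X"
  shows "(\<forall>f \<in> Sub n \<rightarrow>\<^sub>E cells X 0.
            (K_cond X n f \<longleftrightarrow> C_cond X n f) \<and> (C_cond X n f \<longleftrightarrow> CD_cond X n f)) \<and>
         bij_betw (on_zero_cubes n) (K_star X n) {f \<in> Sub n \<rightarrow>\<^sub>E cells X 0. K_cond X n f} \<and>
         bij_betw (on_zero_cubes n) (K_star X n) {f \<in> Sub n \<rightarrow>\<^sub>E cells X 0. C_cond X n f} \<and>
         bij_betw (on_zero_cubes n) (K_star X n) {f \<in> Sub n \<rightarrow>\<^sub>E cells X 0. CD_cond X n f}"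
proof -
  interpret concrete_cubeset X by fact
  interpret gluing_cubeset X by unfold_locales fact
  have "K_cond X n f \<longleftrightarrow> C_cond X n f" "C_cond X n f \<longleftrightarrow> CD_cond X n f" for f
    using K_cond_imp_C_cond C_cond_imp_CD_cond CD_cond_imp_K_cond by blast+
  then show ?thesis using bij_betw_on_zero_cubes[of n] by simp
qed

end
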